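(* Let $f$ be a Bernstein function satisfying (A1) and (A2), with Lévy tail $\bar\mu$ and Sonine pair $(\bar\mu,k)$, so that $\mathcal L(\bar\mu;\lambda)=f(\lambda)/\lambda$ and $\mathcal L(k;\lambda)=1/f(\lambda)$. Assume that $\limsup_{x\to0}\bar\mu(x)\int_0^xk(s)\,ds<1$, and let $T>0$. Then, for any $\phi_0\in\mathbb R$, $\lambda\in\mathbb R\setminus\{0\}$ and $g\in C[0,T]$, the initial value problem $$D^f_{\mathrm{Ce}}\phi(x)=\lambda\phi(x)+g(x),\quad x\in(0,T],\qquad\phi(0)=\phi_0,$$ has a unique solution in $C_{\bar\mu}[0,T]$, which is given by $$\phi(x)=\phi_0\sum_{i=0}^\infty\lambda^i\big(I^f_{\mathrm{Ce}}\big)^i\mathbf 1(x)+\sum_{i=0}^\infty\lambda^i\big(I^f_{\mathrm{Ce}}\big)^{i+1}g(x),$$ where $\mathbf 1$ is the constant function $1$.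
   Context: A Bernstein function with triplet $(a,b,\mu)$ is a function $f(\lambda)=a+b\lambda+\int_{(0,\infty)}(1-e^{-\lambda t})\,\mu(dt)$, $\lambda>0$, with $a,b\ge0$ and $\mu$ a Borel measure on $(0,\infty)$ with $\int\min\{1,t\}\,\mu(dt)<\infty$. Assumptions: (A1) $f$ is a Bernstein function with $f(0+)=0$, $\lim_{x\to\infty}f(x)=\infty$, $\lim_{x\to0}f(x)/x=\infty$, $\lim_{x\to\infty}f(x)/x=0$ (hence the triplet is $(0,0,\mu)$); (A2) $f$ is a complete Bernstein function, i.e. $\mu$ has a completely monotone density with respect to Lebesgue measure. Put $\bar\mu(x)=\mu((x,\infty))$, $x>0$. The conjugate $f^*(x)=x/f(x)$ is again a complete Bernstein function; let $\mu^*$ be its Lévy measure and $k(x)=\mu^*((x,\infty))$, $x>0$. Then $\bar\mu,k$ are completely monotone, locally integrable on $[0,\infty)$, and $(\bar\mu,k)$ is a positive Sonine pair: $\int_0^x\bar\mu(x-t)k(t)\,dt=1$ for all $x>0$; here $\mathcal L(h;\lambda)=\int_0^\infty e^{-\lambda x}h(x)\,dx$. Notation: $(\bar\mu*\phi)(x)=\int_0^x\bar\mu(x-t)\phi(t)\,dt$; $C_{\bar\mu}(0,T]=\{\phi\in C(0,T]\cap L^1(0,T):\bar\mu*\phi\in C^1(0,T]\}$ (one-sided derivative at $T$), $C_{\bar\mu}[0,T]=C[0,T]\cap C_{\bar\mu}(0,T]$. Censored Bernstein derivative of $\phi\in C_{\bar\mu}(0,T]$: $D^f_{\mathrm{Ce}}\phi(x)=\frac{d}{dx}\int_0^x\phi(x-t)\bar\mu(t)\,dt-\phi(x)\bar\mu(x)$,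 $x\in(0,T]$. $I^f_{\mathrm R}\phi(x)=\int_0^x\phi(x-z)k(z)\,dz$ for $x>0$, with value $0$ at $x=0$ for $\phi\in C[0,T]$. $\mathcal K\phi(x)=\int_0^x\bar\mu(r)k(x-r)\phi(r)\,dr$ for $x>0$, $\mathcal K\phi(0)=\phi(0)$; $\mathcal K^0$ is the identity. Censored integral: $I^f_{\mathrm{Ce}}g=\sum_{i=0}^\infty\mathcal K^i[I^f_{\mathrm R}g]$ for $g\in C[0,T]$; it maps $C[0,T]$ into $C[0,T]$, and powers denote iterates (zeroth power = identity). *)

theory Defs
  imports "HOL-Analysis.Analysis"
begin

text \<open>
  Functions on \<open>(0,\<infinity>)\<close>, \<open>(0,T]\<close> or \<open>[0,T]\<close> are total functions on the reals; no notion below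
  depends on the values outside the respective domain.  Integrals are Lebesgue integrals.
\<close>

definition levy_measure :: "real measure \<Rightarrow> bool" where
  "levy_measure mu \<longleftrightarrow>
     sets mu = sets (restrict_space borel {0<..}) \<and>
     (\<integral>\<^sup>+ t. ennreal (min 1 t) \<partial>mu) < \<infinity>"

definition bernstein_triplet :: "(real \<Rightarrow> real) \<Rightarrow> real \<Rightarrow> real \<Rightarrow> real measure \<Rightarrow> bool" where
  "bernstein_triplet f a b mu \<longleftrightarrow>
     0 \<le> a \<and> 0 \<le> b \<and> levy_measure mu \<and>
     (\<forall>l>0. f l = a + b * l + (\<integral>t. (1 - exp (- l * t)) \<partial>mu))"

definition condition_A1 :: "(real \<Rightarrow> real) \<Rightarrow> bool" where
  "condition_A1 f \<longleftrightarrow>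
     (f \<longlongrightarrow> 0) (at_right 0) \<and>
     filterlim f at_top at_top \<and>
     filterlim (\<lambda>x. f x / x) at_top (at_right 0) \<and>
     ((\<lambda>x. f x / x) \<longlongrightarrow> 0) at_top"

definition completely_monotone :: "(real \<Rightarrow> real) \<Rightarrow> bool" where
  "completely_monotone m \<longleftrightarrow>
     (\<forall>n. \<forall>x>0. (deriv ^^ n) m field_differentiable (at x) \<and> 0 \<le> (-1) ^ n * (deriv ^^ n) m x)"

definition complete_bernstein_triplet ::
    "(real \<Rightarrow> real) \<Rightarrow> real \<Rightarrow> real \<Rightarrow> real measure \<Rightarrow> bool" where
  "complete_bernstein_triplet f a b mu \<longleftrightarrow>
     bernstein_triplet f a b mu \<and>
     (\<exists>m. completely_monotone m \<and>
          mu = density (restrict_space lborel {0<..}) (\<lambda>t. ennreal (m t)))"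

text \<open>Meaningful for \<open>x > 0\<close> only; \<^const>\<open>measure\<close> is finite there for a Levy measure.\<close>

definition levy_tail :: "real measure \<Rightarrow> real \<Rightarrow> real" where
  "levy_tail mu x = measure mu {x<..}"

text \<open>
  In the operators below, \<open>mb\<close> and \<open>k\<close> stand for the two members of the Sonine pair.
  Integration runs over the open interval because both are only given on \<open>(0,\<infinity>)\<close>.
\<close>

definition conv :: "(real \<Rightarrow> real) \<Rightarrow> (real \<Rightarrow> real) \<Rightarrow> real \<Rightarrow> real" where
  "conv u v x = (LINT t:{0<..<x}|lborel. u (x - t) * v t)"

text \<open>
  Continuous differentiability on \<open>(0,T]\<close>: the derivative relative to \<open>(0,T]\<close> is the ordinary one at
  interior points and the left one at \<open>T\<close>.
\<close>

definition C1_Ioc :: "real \<Rightarrow> (real \<Rightarrow> real) \<Rightarrow> bool" where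
  "C1_Ioc T F \<longleftrightarrow>
     (\<exists>F'. continuous_on {0<..T} F' \<and>
           (\<forall>x\<in>{0<..T}. (F has_vector_derivative F' x) (at x within {0<..T})))"

definition C_Ioc :: "(real \<Rightarrow> real) \<Rightarrow> real \<Rightarrow> (real \<Rightarrow> real) set" where
  "C_Ioc mb T =
     {\<phi>. continuous_on {0<..T} \<phi> \<and> set_integrable lborel {0<..<T} \<phi> \<and> C1_Ioc T (conv mb \<phi>)}"

definition C_Icc :: "(real \<Rightarrow> real) \<Rightarrow> real \<Rightarrow> (real \<Rightarrow> real) set" where
  "C_Icc mb T = {\<phi>. continuous_on {0..T} \<phi>} \<inter> C_Ioc mb T"

definition censored_deriv :: "(real \<Rightarrow> real) \<Rightarrow> real \<Rightarrow> (real \<Rightarrow> real) \<Rightarrow> real \<Rightarrow> real" where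
  "censored_deriv mb T \<phi> x =
     vector_derivative (conv \<phi> mb) (at x within {0<..T}) - \<phi> x * mb x"

text \<open>The value at \<open>0\<close> is \<open>0\<close>, the integral being over the empty set.\<close>

definition I_R :: "(real \<Rightarrow> real) \<Rightarrow> (real \<Rightarrow> real) \<Rightarrow> real \<Rightarrow> real" where
  "I_R k \<phi> = conv \<phi> k"

definition K_op :: "(real \<Rightarrow> real) \<Rightarrow> (real \<Rightarrow> real) \<Rightarrow> (real \<Rightarrow> real) \<Rightarrow> real \<Rightarrow> real" where
  "K_op mb k \<phi> x =
     (if x = 0 then \<phi> 0 else (LINT r:{0<..<x}|lborel. mb r * k (x - r) * \<phi> r))"

definition I_Ce :: "(real \<Rightarrow> real) \<Rightarrow> (real \<Rightarrow> real) \<Rightarrow> (real \<Rightarrow> real) \<Rightarrow> real \<Rightarrow> real" where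
  "I_Ce mb k g x = (\<Sum>i. (K_op mb k ^^ i) (I_R k g) x)"

definition solves_ivp ::
    "(real \<Rightarrow> real) \<Rightarrow> real \<Rightarrow> real \<Rightarrow> real \<Rightarrow> (real \<Rightarrow> real) \<Rightarrow> (real \<Rightarrow> real) \<Rightarrow> bool" where
  "solves_ivp mb T \<phi>\<^sub>0 l g \<phi> \<longleftrightarrow>
     (\<forall>x\<in>{0<..T}. censored_deriv mb T \<phi> x = l * \<phi> x + g x) \<and> \<phi> 0 = \<phi>\<^sub>0"

end

theory Submission
  imports Defs
begin

text \<open>
  Write \<open>K\<close> for the averaging operator, \<open>R\<close> for convolution with \<open>k\<close> and \<open>J\<close> for the censored
  integral.  Since \<open>mubar * k = 1\<close>, convolving with \<open>k\<close>, respectively \<open>mubar\<close>, turns the equation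
  \<open>D \<phi> = G\<close> into the fixed point equation \<open>\<phi> = K \<phi> + R G\<close> and back; as \<open>K\<close> averages against
  probability densities, a maximum principle shows that its only solutions are \<open>\<phi> 0 + J G\<close>.

  Put \<open>\<kappa> x = \<integral>\<^sub>0\<^sup>x k\<close>.  The Sonine identity gives \<open>mubar \<kappa> < 1\<close> pointwise, and with the limsup
  condition and compactness \<open>mubar \<kappa> \<le> \<gamma> < 1\<close> on \<open>(0,T]\<close>.  Hence, for \<open>E x = \<integral>\<^sub>0\<^sup>x exp (\<omega> (x - t)) k t dt\<close>,
  \<open>K E \<le> \<gamma> E\<close>, so that \<open>\<bar>J g\<bar> \<le> A E / (1 - \<gamma>)\<close> whenever \<open>\<bar>g x\<bar> \<le> A exp (\<omega> x)\<close>.  As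
  \<open>E x \<le> exp (\<omega> x) \<integral>\<^sub>0\<^sup>T exp (- \<omega> t) k t dt\<close> and the last factor tends to \<open>0\<close> for \<open>\<omega> \<rightarrow> \<infinity>\<close>, the
  operator \<open>l J\<close> is a contraction in a weighted sup norm for every \<open>l\<close>; its Neumann series solves
  \<open>\<phi> = \<phi>\<^sub>0 + J (l \<phi> + g)\<close> uniquely.
\<close>

section \<open>Convolution on the half-line\<close>

text \<open>Since \<open>K\<close> fixes constants, it does not contract the sup norm. A gain
  appears only on functions that are small at 0 in the way \<kappa> is, and \<open>E\<close> is a
  family of such functions with a free growth rate. The Sonine identity is itself derived: the two
  tails have Laplace transforms f(l)/l and 1/f(l), whose product 1/l is the transform of the
  constant 1, and the convolution of the tails is continuous. The bound mubar \<kappa> < 1 comes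
  from replacing mubar(x - s) by mubar(x) under the integral in that identity; it is strict because
  mubar is strictly decreasing where it is positive. The completely monotone density makes mubar
  continuous and strictly decreasing in this sense. The conjugate enters as a Bernstein triplet,
  from which its tail k is known to be nonincreasing, hence continuous off a countable set. All
  convolution estimates are therefore phrased for nonnegative, nonincreasing, locally integrable
  kernels. Their values at 0 and on the negative half-line carry no meaning; nonnegativity
  everywhere merely saves side conditions.\<close>

definition tail_kernel :: "(real \<Rightarrow> real) \<Rightarrow> bool" where
  "tail_kernel p \<longleftrightarrow>
     p \<in> borel_measurable borel \<and> (\<forall>x. 0 \<le> p x) \<and> antimono_on {0<..} p \<and>
     (\<forall>x>0. set_integrable lborel {0<..<x} p)"

text \<open>Bounded factors and primitives become dominated convolutions with the constant kernel 1,
  so one set of estimates covers them too.\<close>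

lemma tail_kernel_const: "0 \<le> c \<Longrightarrow> tail_kernel (\<lambda>_. c)"
  by (auto simp: tail_kernel_def monotone_on_def set_integrable_def)

lemma tail_kernelD:
  assumes "tail_kernel p"
  shows "p \<in> borel_measurable borel" "0 \<le> p x"
    "0 < x \<Longrightarrow> x \<le> y \<Longrightarrow> p y \<le> p x"
    "set_integrable lborel {0<..<x} p"
proof -
  show "set_integrable lborel {0<..<x} p"
    using assms by (cases "0 < x") (auto simp: tail_kernel_def)
qed (use assms in \<open>auto simp: tail_kernel_def monotone_on_def\<close>)

text \<open>Countable sets are null, so under an integral this replaces the continuity that a merely
  monotone kernel may lack.\<close>

lemma tail_kernel_countable_discontinuities:
  assumes "tail_kernel p"
  shows "countable {x\<in>{0<..}. \<not> isCont p x}"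
proof -
  have "mono_on {0<..} (\<lambda>x. - p x)"
    using tail_kernelD(3)[OF assms] by (auto simp: monotone_on_def)
  then have "countable {x\<in>{0<..}. \<not> isCont (\<lambda>x. - p x) x}"
    by (intro mono_on_ctble_discont_open) auto
  then show ?thesis
    by (rule countable_subset[rotated]) (auto dest: isCont_minus)
qed

lemma reflect_indicator:
  "indicator {0<..<x} (x - t) = (indicator {0<..<x} t :: real)" for x t :: real
  by (auto simp: indicator_def)

lemma conv_commute: "conv u v x = conv v u x"
proof -
  have "conv u v x = (\<integral>t. indicator {0<..<x} (x - t) *\<^sub>R (u t * v (x - t)) \<partial>lborel)"
    unfolding conv_def set_lebesgue_integral_def
    by (subst lborel_integral_real_affine[where c="-1" and t=x]) simp_all
  then show ?thesis
    unfolding conv_def set_lebesgue_integral_def reflect_indicator by (simp add: mult.commute)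
qed

lemma set_integrable_reflect_iff:
  fixes h :: "real \<Rightarrow> real"
  shows "set_integrable lborel {0<..<x} (\<lambda>t. h (x - t)) \<longleftrightarrow> set_integrable lborel {0<..<x} h"
proof -
  have "set_integrable lborel {0<..<x} h \<longleftrightarrow>
        integrable lborel (\<lambda>t. indicator {0<..<x} (x + (-1) * t) *\<^sub>R h (x + (-1) * t))"
    unfolding set_integrable_def by (subst lborel_integrable_real_affine_iff) auto
  then show ?thesis
    unfolding set_integrable_def by (simp add: reflect_indicator)
qed

lemma conv_cong:
  assumes "\<And>t. 0 < t \<Longrightarrow> t < x \<Longrightarrow> u t = u' t" "\<And>t. 0 < t \<Longrightarrow> t < x \<Longrightarrow> v t = v' t"
  shows "conv u v x = conv u' v' x"
  unfolding conv_def by (rule set_lebesgue_integral_cong) (auto simp: assms)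

text \<open>On the fixed interval (0,1) the dependence on x sits in the integrand alone, which is
  the form that dominated convergence needs.\<close>

lemma conv_scale:
  assumes "0 < x"
  shows "conv u v x = x * (LINT s:{0<..<1}|lborel. u (x * (1 - s)) * v (x * s))"
proof -
  have ind: "indicator {0<..<x} (x * s) = (indicator {0<..<1} s :: real)" for s
    using assms by (auto simp: indicator_def zero_less_mult_iff)
  have "conv u v x = x * (\<integral>s. indicator {0<..<x} (x * s) *\<^sub>R (u (x - x * s) * v (x * s)) \<partial>lborel)"
    unfolding conv_def set_lebesgue_integral_def
    using assms by (subst lborel_integral_real_affine[where c=x and t=0]) simp_all
  then show ?thesis
    unfolding set_lebesgue_integral_def ind by (simp add: right_diff_distrib)
qed

text \<open>
  On each half of \<open>(0,x)\<close> one of the two factors is bounded by its value at \<open>x/2\<close>.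
\<close>

lemma tail_kernel_mult_integrable:
  assumes p: "tail_kernel p" and q: "tail_kernel q"
  shows "set_integrable lborel {0<..<x} (\<lambda>t. p (x - t) * q t)"
proof (rule set_integrable_bound)
  have [measurable]: "p \<in> borel_measurable borel" "q \<in> borel_measurable borel"
    using p q by (auto dest: tail_kernelD)
  show "set_integrable lborel {0<..<x} (\<lambda>t. p (x/2) * q t + p (x - t) * q (x/2))"
  proof (rule set_integral_add(1))
    show "set_integrable lborel {0<..<x} (\<lambda>t. p (x/2) * q t)"
      by (rule set_integrable_mult_right) (rule tail_kernelD(4)[OF q])
    show "set_integrable lborel {0<..<x} (\<lambda>t. p (x - t) * q (x/2))"
      by (rule set_integrable_mult_left) (simp only: set_integrable_reflect_iff tail_kernelD(4)[OF p])
  qed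
  show "set_borel_measurable lborel {0<..<x} (\<lambda>t. p (x - t) * q t)"
    unfolding set_borel_measurable_def by measurable
  have "p (x - t) * q t \<le> p (x/2) * q t + p (x - t) * q (x/2)" if "0 < t" "t < x" for t
  proof (cases "t \<le> x/2")
    case True
    then have "p (x - t) * q t \<le> p (x/2) * q t"
      using that by (intro mult_right_mono tail_kernelD(2,3)[OF p] tail_kernelD(2,3)[OF q]) auto
    then show ?thesis
      using tail_kernelD(2)[OF p, of "x - t"] tail_kernelD(2)[OF q, of "x/2"] by (simp add: add_increasing2)
  next
    case False
    then have "p (x - t) * q t \<le> p (x - t) * q (x/2)"
      using that by (intro mult_left_mono tail_kernelD(2,3)[OF p] tail_kernelD(2,3)[OF q]) auto
    then show ?thesis
      using tail_kernelD(2)[OF p, of "x/2"] tail_kernelD(2)[OF q, of t] by (simp add: add_increasing)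
  qed
  then show "AE t in lborel. t \<in> {0<..<x} \<longrightarrow>
      norm (p (x - t) * q t) \<le> norm (p (x/2) * q t + p (x - t) * q (x/2))"
    using tail_kernelD(2)[OF p] tail_kernelD(2)[OF q] by (intro AE_I2) (simp add: abs_mult)
qed

section \<open>Convolutions of functions dominated by monotone kernels\<close>

lemma set_borel_measurable_restrict:
  fixes h :: "real \<Rightarrow> real"
  assumes "set_borel_measurable lborel {0<..<x} h"
  shows "(\<lambda>t. indicator {0<..<x} t * h t) \<in> borel_measurable borel"
  using assms by (simp add: set_borel_measurable_def)

lemma set_borel_measurable_mult:
  fixes h h' :: "'a \<Rightarrow> real"
  assumes "set_borel_measurable M A h" "set_borel_measurable M A h'"
  shows "set_borel_measurable M A (\<lambda>t. h t * h' t)"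
proof -
  have "(\<lambda>t. (indicator A t *\<^sub>R h t) * (indicator A t *\<^sub>R h' t)) \<in> borel_measurable M"
    using assms unfolding set_borel_measurable_def by (rule borel_measurable_times)
  then show ?thesis
    unfolding set_borel_measurable_def by (rule measurable_cong[THEN iffD1, rotated]) (auto simp: indicator_def)
qed

lemma set_borel_measurable_global:
  assumes "h \<in> borel_measurable borel"
  shows "set_borel_measurable lborel {a<..<b::real} (h :: real \<Rightarrow> real)"
  using assms unfolding set_borel_measurable_def by simp

lemma set_borel_measurable_reflect:
  fixes h :: "real \<Rightarrow> real"
  assumes "set_borel_measurable lborel {0<..<x} h"
  shows "set_borel_measurable lborel {0<..<x} (\<lambda>t. h (x - t))"
proof -
  note [measurable] = set_borel_measurable_restrict[OF assms]
  have "(\<lambda>t. indicator {0<..<x} (x - t) * h (x - t)) \<in> borel_measurable borel"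
    by (rule measurable_compose[OF _ set_borel_measurable_restrict[OF assms]]) simp
  then show ?thesis unfolding set_borel_measurable_def reflect_indicator by simp
qed

lemma dominated_conv_integrable:
  assumes p: "tail_kernel p" and q: "tail_kernel q"
    and mu: "set_borel_measurable lborel {0<..<x} u" and mv: "set_borel_measurable lborel {0<..<x} v"
    and u: "\<And>t. 0 < t \<Longrightarrow> t < x \<Longrightarrow> \<bar>u t\<bar> \<le> A * p t"
    and v: "\<And>t. 0 < t \<Longrightarrow> t < x \<Longrightarrow> \<bar>v t\<bar> \<le> B * q t"
  shows "set_integrable lborel {0<..<x} (\<lambda>t. u (x - t) * v t)"
proof (rule set_integrable_bound)
  show "set_integrable lborel {0<..<x} (\<lambda>t. (A * B) * (p (x - t) * q t))"
    by (intro set_integrable_mult_right tail_kernel_mult_integrable p q)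
  show "set_borel_measurable lborel {0<..<x} (\<lambda>t. u (x - t) * v t)"
    by (intro set_borel_measurable_mult set_borel_measurable_reflect mu mv)
  \<comment> \<open>\<open>A * p (x - t)\<close> is nonnegative because it dominates an absolute
    value, which settles the side condition of the product bound.\<close>
  have "\<bar>u (x - t)\<bar> * \<bar>v t\<bar> \<le> (A * p (x - t)) * (B * q t)" if "0 < t" "t < x" for t
    using that u[of "x - t"] by (intro mult_mono u v) (auto intro: order_trans[OF abs_ge_zero])
  then have *: "\<bar>u (x - t)\<bar> * \<bar>v t\<bar> \<le> \<bar>A * B * (p (x - t) * q t)\<bar>" if "0 < t" "t < x" for t
    using that by (intro order_trans[OF _ abs_ge_self]) (auto simp: mult_ac)
  show "AE t in lborel. t \<in> {0<..<x} \<longrightarrow> norm (u (x - t) * v t) \<le> norm (A * B * (p (x - t) * q t))"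
    using * by (intro AE_I2) (auto simp: abs_mult)
qed

text \<open>
  After the substitution \<open>t = xs\<close> the integrands for all \<open>x \<ge> d\<close> are dominated by the
  integrand at \<open>x = d\<close>, because both kernels decrease.
\<close>

lemma continuous_on_conv:
  assumes p: "tail_kernel p" and q: "tail_kernel q" and AB: "0 \<le> A" "0 \<le> B" and D: "countable D"
    and mu: "set_borel_measurable lborel {0<..<T} u" and mv: "set_borel_measurable lborel {0<..<T} v"
    and u: "\<And>t. 0 < t \<Longrightarrow> t < T \<Longrightarrow> \<bar>u t\<bar> \<le> A * p t"
    and v: "\<And>t. 0 < t \<Longrightarrow> t < T \<Longrightarrow> \<bar>v t\<bar> \<le> B * q t"
    and cu: "\<And>t. 0 < t \<Longrightarrow> t < T \<Longrightarrow> t \<notin> D \<Longrightarrow> isCont u t"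
    and cv: "\<And>t. 0 < t \<Longrightarrow> t < T \<Longrightarrow> t \<notin> D \<Longrightarrow> isCont v t"
  shows "continuous_on {0<..T} (conv u v)"
proof (rule continuous_on_sequentiallyI)
  fix X :: "nat \<Rightarrow> real" and a
  assume X: "\<forall>n. X n \<in> {0<..T}" and a: "a \<in> {0<..T}" and lim: "X \<longlonglongrightarrow> a"
  \<comment> \<open>A lower cutoff: from some index on the sequence stays above d, and the integrand
    at d serves as the common majorant.\<close>
  define d where "d = a / 2"
  have d: "0 < d" "d < a" using a by (auto simp: d_def)
  from order_tendstoD(1)[OF lim d(2)] obtain N where N: "\<And>n. n \<ge> N \<Longrightarrow> d < X n"
    by (auto simp: eventually_sequentially)
  define Y where "Y n = X (n + N)" for n
  have Y: "d < Y n" "0 < Y n" "Y n \<le> T" for n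
    using N[of "n + N"] X d by (auto simp: Y_def intro: less_trans)
  have Ylim: "Y \<longlonglongrightarrow> a" unfolding Y_def using lim by (rule LIMSEQ_ignore_initial_segment)
  let ?F = "\<lambda>y s. indicator {0<..<1::real} s *\<^sub>R (u (y * (1 - s)) * v (y * s))"
  let ?u = "\<lambda>t. indicator {0<..<T} t * u t" and ?v = "\<lambda>t. indicator {0<..<T} t * v t"
  have meas: "?F y \<in> borel_measurable lborel" if "0 < y" "y \<le> T" for y
  proof -
    have "0 < y * (1 - s) \<and> y * (1 - s) < T \<and> 0 < y * s \<and> y * s < T" if "0 < s" "s < 1" for s
    proof -
      have "y * (1 - s) < y" "y * s < y" using that \<open>0 < y\<close> by auto
      from this[THEN order.strict_trans2, OF \<open>y \<le> T\<close>] show ?thesis using that \<open>0 < y\<close> by simp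
    qed
    then have "?F y = (\<lambda>s. indicator {0<..<1} s * (?u (y * (1 - s)) * ?v (y * s)))"
      by (auto simp: indicator_def fun_eq_iff)
    moreover have [measurable]: "?u \<in> borel_measurable borel" "?v \<in> borel_measurable borel"
      using mu mv by (auto dest: set_borel_measurable_restrict)
    have [measurable]: "(\<lambda>s. ?u (y * (1 - s))) \<in> borel_measurable borel"
      by (rule measurable_compose[where f="\<lambda>s. y * (1 - s)" and g="?u" and N=borel]) measurable
    have [measurable]: "(\<lambda>s. ?v (y * s)) \<in> borel_measurable borel"
      by (rule measurable_compose[where f="\<lambda>s. y * s" and g="?v" and N=borel]) measurable
    have "(\<lambda>s. indicator {0<..<1} s * (?u (y * (1 - s)) * ?v (y * s))) \<in> borel_measurable lborel"
      by simp
    ultimately show ?thesis by simp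
  qed
  have "(\<lambda>n. \<integral>s. ?F (Y n) s \<partial>lborel) \<longlonglongrightarrow> (\<integral>s. ?F a s \<partial>lborel)"
  proof (rule integral_dominated_convergence)
    show "?F a \<in> borel_measurable lborel" "?F (Y n) \<in> borel_measurable lborel" for n
      by (rule meas; use a Y in simp)+
    let ?W = "\<lambda>s. indicator {0<..<1::real} s *\<^sub>R (A * B * (p (d * (1 - s)) * q (d * s)))"
    have "integrable lborel (\<lambda>t. indicator {0<..<d} t *\<^sub>R (A * B * (p (d - t) * q t)))"
      using tail_kernel_mult_integrable[OF p q, of d]
      by (intro set_integrable_mult_right[unfolded set_integrable_def]) (auto simp: set_integrable_def)
    from lborel_integrable_real_affine[OF this, of d 0] d
    have "integrable lborel (\<lambda>s. indicator {0<..<d} (d * s) *\<^sub>R (A * B * (p (d - d * s) * q (d * s))))"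
      by simp
    moreover have "indicator {0<..<d} (d * s) = (indicator {0<..<1} s :: real)" for s
      using d by (auto simp: indicator_def zero_less_mult_iff)
    ultimately show "integrable lborel ?W" by (simp add: right_diff_distrib)
    show "AE s in lborel. norm (?F (Y n) s) \<le> ?W s" for n
    proof (rule AE_I2)
      fix s :: real
      show "norm (?F (Y n) s) \<le> ?W s"
      proof (cases "s \<in> {0<..<1}")
        case True
        then have s: "0 < s" "s < 1" by auto
        have "Y n * (1 - s) < Y n" "Y n * s < Y n" using s Y(2)[of n] by auto
        note lt = this[THEN order.strict_trans2, OF Y(3)]
        have pos: "0 < Y n * (1 - s)" "0 < Y n * s" "0 < d * (1 - s)" "0 < d * s" using s Y(2) d by auto
        have U: "\<bar>u (Y n * (1 - s))\<bar> \<le> A * p (Y n * (1 - s))"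
          using lt pos by (intro u)
        have V: "\<bar>v (Y n * s)\<bar> \<le> B * q (Y n * s)"
          using lt pos by (intro v)
        have P: "p (Y n * (1 - s)) \<le> p (d * (1 - s))"
          using Y(1)[of n] s pos by (intro tail_kernelD(3)[OF p]) auto
        have Q: "q (Y n * s) \<le> q (d * s)"
          using Y(1)[of n] s pos by (intro tail_kernelD(3)[OF q]) auto
        have "A * p (Y n * (1 - s)) \<le> A * p (d * (1 - s))" "B * q (Y n * s) \<le> B * q (d * s)"
          using P Q AB by (auto intro: mult_left_mono)
        then have "\<bar>u (Y n * (1 - s))\<bar> * \<bar>v (Y n * s)\<bar> \<le> (A * p (d * (1 - s))) * (B * q (d * s))"
          using U V AB by (intro mult_mono) (auto intro!: mult_nonneg_nonneg tail_kernelD(2)[OF p] tail_kernelD(2)[OF q])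
        then show ?thesis using True by (simp add: abs_mult mult_ac)
      qed auto
    qed
    \<comment> \<open>For the remaining s both \<open>a * (1 - s)\<close> and \<open>a * s\<close>
      avoid \<open>D\<close>, so both factors are continuous there.\<close>
    have "AE s in lborel. s \<notin> (\<lambda>z. 1 - z / a) ` D \<union> (\<lambda>z. z / a) ` D"
      using D by (intro AE_not_in countable_imp_null_set_lborel) auto
    then show "AE s in lborel. (\<lambda>n. ?F (Y n) s) \<longlonglongrightarrow> ?F a s"
    proof eventually_elim
      case (elim s)
      show ?case
      proof (cases "s \<in> {0<..<1}")
        case True
        then have s: "0 < s" "s < 1" by auto
        have "a * (1 - s) < a" "a * s < a" "a \<le> T" using s a by auto
        note lt = this(1,2)[THEN order.strict_trans2, OF this(3)]
        have D1: "a * (1 - s) \<notin> D" "a * s \<notin> D"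
          using elim a by (auto simp: image_iff field_simps)
        have "isCont u (a * (1 - s))" "isCont v (a * s)"
          using D1 lt a s by (auto intro!: cu cv)
        then show ?thesis
          by (auto intro!: tendsto_intros Ylim elim!: isCont_tendsto_compose)
      qed auto
    qed
  qed
  then have "(\<lambda>n. Y n * (\<integral>s. ?F (Y n) s \<partial>lborel)) \<longlonglongrightarrow> a * (\<integral>s. ?F a s \<partial>lborel)"
    by (intro tendsto_mult Ylim)
  moreover have "(\<lambda>n. conv u v (Y n)) = (\<lambda>n. Y n * (\<integral>s. ?F (Y n) s \<partial>lborel))"
    using Y by (simp add: conv_scale set_lebesgue_integral_def)
  moreover have "conv u v a = a * (\<integral>s. ?F a s \<partial>lborel)"
    using a by (simp add: conv_scale set_lebesgue_integral_def)
  ultimately have "(\<lambda>n. conv u v (Y n)) \<longlonglongrightarrow> conv u v a" by simp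
  then show "(\<lambda>n. conv u v (X n)) \<longlonglongrightarrow> conv u v a"
    unfolding Y_def by (rule LIMSEQ_offset)
qed

text \<open>
  Swapping the order of integration leaves the inner integral \<open>conv p q (x - s) = 1\<close>.
\<close>

lemma conv_conv_of_conv_eq_1:
  assumes p: "tail_kernel p" and q: "tail_kernel q"
    and one: "\<And>y. 0 < y \<Longrightarrow> conv p q y = 1"
    and G: "set_integrable lborel {0<..<x} G"
  shows "conv p (conv q G) x = (LINT s:{0<..<x}|lborel. G s)"
proof -
  define G' where "G' s = indicator {0<..<x} s * G s" for s
  \<comment> \<open>As a function of t, \<open>P s\<close> is the convolution integrand of p and q
    on (0, x - s), translated by s; its mass is therefore 1 whenever s < x.\<close>
  define P where "P s t = (if s < t \<and> t < x then p (x - t) * q (t - s) else 0)" for s t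
  define W where "W s t = G' s * P s t" for s t
  have G': "integrable lborel G'"
    using G by (simp add: set_integrable_def G'_def[abs_def])
  then have [measurable]: "G' \<in> borel_measurable borel"
    using borel_measurable_integrable by force
  have [measurable]: "p \<in> borel_measurable borel" "q \<in> borel_measurable borel"
    using p q by (auto dest: tail_kernelD)
  have P_shift: "P s (s + 1 * t) = indicator {0<..<x - s} t *\<^sub>R (p (x - s - t) * q t)" for s t
    by (auto simp: P_def indicator_def algebra_simps)
  have P_int: "integrable lborel (P s)" for s
  proof -
    have "integrable lborel (\<lambda>t. P s (s + 1 * t))"
      using tail_kernel_mult_integrable[OF p q, of "x - s"] unfolding P_shift set_integrable_def .
    then show ?thesis
      using lborel_integrable_real_affine_iff[of 1 "P s" s] by simp
  qed
  have P_1: "(\<integral>t. P s t \<partial>lborel) = 1" if "s < x" for s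
  proof -
    have "(\<integral>t. P s t \<partial>lborel) = \<bar>1\<bar> *\<^sub>R (\<integral>t. P s (s + 1 * t) \<partial>lborel)"
      by (rule lborel_integral_real_affine) simp
    then have "(\<integral>t. P s t \<partial>lborel) = conv p q (x - s)"
      unfolding P_shift conv_def set_lebesgue_integral_def by simp
    then show ?thesis using one that by simp
  qed
  have P_nonneg: "0 \<le> P s t" for s t
    using tail_kernelD(2)[OF p] tail_kernelD(2)[OF q] by (simp add: P_def)
  \<comment> \<open>Integrating out t preserves \<open>G'\<close> and its modulus, since
    \<open>P s\<close> is nonnegative with mass 1; the statement for the modulus is the Fubini
    hypothesis. For s \<ge> x both sides vanish through the cutoff in \<open>G'\<close>.\<close>
  have W1: "(\<integral>t. W s t \<partial>lborel) = G' s" and W1': "(\<integral>t. norm (W s t) \<partial>lborel) = norm (G' s)" for s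
    using P_1[of s] P_nonneg[of s] by (cases "s < x"; simp add: W_def G'_def abs_mult)+
  have W_meas: "case_prod W \<in> borel_measurable (lborel \<Otimes>\<^sub>M lborel)"
    unfolding W_def P_def by measurable
  have "integrable (lborel \<Otimes>\<^sub>M lborel) (case_prod W)"
  proof (rule lborel_pair.Fubini_integrable[OF W_meas])
    show "integrable lborel (\<lambda>s. \<integral>t. norm (case_prod W (s, t)) \<partial>lborel)"
      using G' by (simp add: W1' del: real_norm_def)
    show "AE s in lborel. integrable lborel (\<lambda>t. case_prod W (s, t))"
      using P_int by (simp add: W_def)
  qed
  then have "(\<integral>t. (\<integral>s. W s t \<partial>lborel) \<partial>lborel) = (\<integral>s. (\<integral>t. W s t \<partial>lborel) \<partial>lborel)"
    by (rule lborel_pair.Fubini_integral)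
  moreover have "(\<integral>s. W s t \<partial>lborel) = indicator {0<..<x} t *\<^sub>R (p (x - t) * conv q G t)" for t
  proof (cases "t < x")
    case True
    have "(\<integral>s. W s t \<partial>lborel) = (\<integral>s. p (x - t) * (indicator {0<..<t} s *\<^sub>R (q (t - s) * G s)) \<partial>lborel)"
      using True by (intro Bochner_Integration.integral_cong) (auto simp: W_def P_def G'_def indicator_def)
    also have "\<dots> = p (x - t) * conv q G t"
      unfolding conv_def set_lebesgue_integral_def by (rule integral_mult_right_zero)
    finally show ?thesis
      using True by (cases "0 < t") (auto simp: conv_def indicator_def set_lebesgue_integral_def)
  qed (simp add: W_def P_def)
  ultimately show ?thesis
    unfolding conv_def[of p] set_lebesgue_integral_def W1 by (simp add: G'_def)
qed

text \<open>\<open>H\<close> may be unbounded at 0, so the fundamental theorem of calculus is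
  applied on [a,T] with 0 < a < x, and the integral over (0,a) enters as a constant.\<close>

lemma has_vector_derivative_LINT:
  fixes H :: "real \<Rightarrow> real"
  assumes cont: "continuous_on {0<..T} H" and int: "set_integrable lborel {0<..<T} H"
    and x: "x \<in> {0<..T}"
  shows "((\<lambda>y. LINT s:{0<..<y}|lborel. H s) has_vector_derivative H x) (at x within {0<..T})"
proof -
  define a where "a = x / 2"
  have a: "0 < a" "a < x" "x \<le> T" using x by (auto simp: a_def)
  have split: "(LINT s:{0<..<y}|lborel. H s) = (LINT s:{0<..<a}|lborel. H s) + integral {a..y} H"
    if y: "y \<in> {a..T}" for y
  proof (cases "y = a")
    case False
    have ae: "set_integrable lborel {0<..<a} H" "set_integrable lborel {a..<y} H"
      by (rule set_integrable_subset[OF int], use y a in auto)+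
    have "{0<..<y} = {0<..<a} \<union> {a..<y}" using a y by auto
    then have "(LINT s:{0<..<y}|lborel. H s) = (LINT s:{0<..<a}|lborel. H s) + (LINT s:{a..<y}|lborel. H s)"
      using ae by (simp add: set_integral_Un ivl_disj_int)
    also have "(LINT s:{a..<y}|lborel. H s) = integral {a..<y} H"
      by (rule set_borel_integral_eq_integral(2)[OF ae(2)])
    also have "\<dots> = integral {a..y} H"
      by (rule integral_subset_negligible) (auto intro: negligible_subset[of "{y}"])
    finally show ?thesis .
  qed simp
  have der: "((\<lambda>y. (LINT s:{0<..<a}|lborel. H s) + integral {a..y} H) has_vector_derivative 0 + H x)
      (at x within {a..T})"
    by (intro has_vector_derivative_add has_vector_derivative_const integral_has_vector_derivative
        continuous_on_subset[OF cont]) (use a in auto)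
  have "((\<lambda>y. LINT s:{0<..<y}|lborel. H s) has_vector_derivative H x) (at x within {a..T})"
    using has_vector_derivative_transform[OF _ split der] a by simp
  moreover have "at x within {a..T} = at x within {0<..T}"
    by (rule at_within_nhd[where S="{a<..}"]) (use a in auto)
  ultimately show ?thesis by simp
qed

lemma LINT_tendsto_0:
  fixes H :: "real \<Rightarrow> real"
  assumes "0 < T" and int: "set_integrable lborel {0<..<T} H"
  shows "((\<lambda>x. LINT s:{0<..<x}|lborel. H s) \<longlongrightarrow> 0) (at_right 0)"
proof (rule tendsto_at_right_sequentially[OF \<open>0 < T\<close>])
  fix X :: "nat \<Rightarrow> real"
  assume X: "\<And>n. 0 < X n" "\<And>n. X n < T" "X \<longlonglongrightarrow> 0"
  have "(\<lambda>n. \<integral>s. indicator {0<..<X n} s *\<^sub>R H s \<partial>lborel) \<longlonglongrightarrow> (\<integral>s. 0 \<partial>(lborel :: real measure))"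
  proof (rule integral_dominated_convergence)
    show "integrable lborel (\<lambda>s. norm (indicator {0<..<T} s *\<^sub>R H s))"
      using int unfolding set_integrable_def by (rule integrable_norm)
    show "(\<lambda>s. indicator {0<..<X n} s *\<^sub>R H s) \<in> borel_measurable lborel" for n
    proof -
      have "set_integrable lborel {0<..<X n} H"
        by (rule set_integrable_subset[OF int]) (use X(2)[of n] in auto)
      then show ?thesis unfolding set_integrable_def by (rule borel_measurable_integrable)
    qed
    show "AE s in lborel. norm (indicator {0<..<X n} s *\<^sub>R H s) \<le> norm (indicator {0<..<T} s *\<^sub>R H s)" for n
      using X(2)[of n] by (intro AE_I2) (auto simp: indicator_def)
    show "AE s in lborel. (\<lambda>n. indicator {0<..<X n} s *\<^sub>R H s) \<longlonglongrightarrow> 0"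
    proof (rule AE_I2)
      fix s :: real
      show "(\<lambda>n. indicator {0<..<X n} s *\<^sub>R H s) \<longlonglongrightarrow> 0"
      proof (cases "0 < s")
        case True
        from order_tendstoD(2)[OF X(3) True] have "eventually (\<lambda>n. 0 = indicator {0<..<X n} s *\<^sub>R H s) sequentially"
          by eventually_elim (auto simp: indicator_def)
        then show ?thesis by (rule Lim_transform_eventually[OF tendsto_const])
      qed (auto simp: indicator_def)
    qed
  qed simp
  then show "(\<lambda>n. LINT s:{0<..<X n}|lborel. H s) \<longlonglongrightarrow> 0"
    by (simp add: set_lebesgue_integral_def)
qed

lemma continuous_on_Icc_of_Ioc:
  fixes F :: "real \<Rightarrow> real"
  assumes "continuous_on {0<..T} F" "(F \<longlongrightarrow> F 0) (at_right 0)"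
  shows "continuous_on {0..T} F"
  unfolding continuous_on_def
proof
  fix x assume x: "x \<in> {0..T}"
  show "(F \<longlongrightarrow> F x) (at x within {0..T})"
  proof (cases "x = 0")
    case True
    have "(F \<longlongrightarrow> F 0) (at 0 within {0<..T})"
      by (rule tendsto_within_subset[OF assms(2)]) auto
    moreover have "{0..T} - {0} = {0<..T} - {0}" by auto
    then have "at (0::real) within {0..T} = at 0 within {0<..T}"
      by (simp add: at_within_def)
    ultimately show ?thesis using True by simp
  next
    case False
    then have "at x within {0..T} = at x within {0<..T}"
      using x by (intro at_within_nhd[where S="{0<..}"]) auto
    with assms(1) x False show ?thesis by (auto simp: continuous_on_def)
  qed
qed

section \<open>Contraction estimates for a Sonine pair\<close>

lemma abs_LINT_le:
  fixes f F :: "'a \<Rightarrow> real"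
  assumes "set_integrable M A f" "set_integrable M A F" "\<And>x. x \<in> A \<Longrightarrow> \<bar>f x\<bar> \<le> F x"
  shows "\<bar>LINT x:A|M. f x\<bar> \<le> (LINT x:A|M. F x)"
proof -
  have "norm (LINT x:A|M. f x) \<le> (LINT x:A|M. norm (f x))"
    by (rule set_integral_norm_bound[OF assms(1)])
  also have "\<dots> \<le> (LINT x:A|M. F x)"
    using assms by (intro set_integral_mono) (auto intro: set_integrable_abs)
  finally show ?thesis by simp
qed

lemma continuous_on_Icc_set_borel_measurable:
  fixes \<phi> :: "real \<Rightarrow> real"
  assumes "continuous_on {0..T} \<phi>" "x \<le> T"
  shows "set_borel_measurable lborel {0<..<x} \<phi>"
proof -
  have "continuous_on {0<..<x} \<phi>"
    by (rule continuous_on_subset[OF assms(1)]) (use assms(2) in auto)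
  then show ?thesis
    unfolding set_borel_measurable_def using borel_measurable_continuous_on_indicator[of "{0<..<x}" \<phi>] by simp
qed

lemma continuous_on_Icc_bounded:
  fixes \<phi> :: "real \<Rightarrow> real"
  assumes "continuous_on {0..T} \<phi>"
  obtains M where "0 \<le> M" "\<And>x. x \<in> {0..T} \<Longrightarrow> \<bar>\<phi> x\<bar> \<le> M"
proof -
  have "bounded (\<phi> ` {0..T})"
    by (intro compact_imp_bounded compact_continuous_image assms) simp
  then obtain b where "0 < b" "\<And>x. x \<in> {0..T} \<Longrightarrow> \<bar>\<phi> x\<bar> \<le> b"
    unfolding bounded_pos by auto
  then show thesis by (intro that[of b]) auto
qed

text \<open>Makes derivatives relative to (0,T] unique, including the left one at T, so that
  \<open>has_vector_derivative\<close> determines \<open>vector_derivative\<close>.\<close>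

lemma at_within_Ioc_neq_bot:
  fixes x :: real
  assumes "x \<in> {0<..T}"
  shows "at x within {0<..T} \<noteq> bot"
proof -
  have "x islimpt {0<..T}"
    by (rule islimpt_subset[OF islimpt_greaterThanLessThan2[of 0 x]]) (use assms in auto)
  then show ?thesis using trivial_limit_within by auto
qed

text \<open>Passes an operator, evaluated at a point, through a uniformly convergent series. The
  Lipschitz bound is asked for only between the sequence and its limit, where continuity of the
  functions involved is known.\<close>

lemma tendsto_of_uniform_limit:
  fixes L :: "('a \<Rightarrow> real) \<Rightarrow> real"
  assumes lim: "uniform_limit S F f sequentially" and C: "0 \<le> C"
    and L: "\<And>n e. (\<And>x. x \<in> S \<Longrightarrow> \<bar>F n x - f x\<bar> \<le> e) \<Longrightarrow> \<bar>L (F n) - L f\<bar> \<le> C * e"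
  shows "(\<lambda>n. L (F n)) \<longlonglongrightarrow> L f"
proof (rule tendstoI)
  fix e :: real assume e: "0 < e"
  define d where "d = e / (C + 1)"
  have d: "0 < d" "C * d < e" using e C by (auto simp: d_def field_simps)
  from uniform_limitD[OF lim d(1)] show "\<forall>\<^sub>F n in sequentially. dist (L (F n)) (L f) < e"
  proof eventually_elim
    case (elim n)
    then have "\<bar>L (F n) - L f\<bar> \<le> C * d"
      by (intro L) (auto simp: dist_real_def less_imp_le)
    with d show ?case by (simp add: dist_real_def)
  qed
qed

text \<open>All that is kept of f and its Levy measures. Continuity is required of \<open>mb\<close>
  because it multiplies the unknown outside any integral in the censored derivative;
  \<open>k\<close> occurs only under integrals, where monotonicity suffices.\<close>

locale sonine_contraction =
  fixes mb k :: "real \<Rightarrow> real" and T \<gamma> :: real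
  assumes mb: "tail_kernel mb" and k: "tail_kernel k"
    and mb_cont: "\<And>x. 0 < x \<Longrightarrow> isCont mb x"
    and sonine: "\<And>x. 0 < x \<Longrightarrow> conv mb k x = 1"
    and T_pos: "0 < T" and \<gamma>_less_1: "\<gamma> < 1"
    and mb_le: "\<And>x. 0 < x \<Longrightarrow> x \<le> T \<Longrightarrow> mb x * (LINT s:{0<..<x}|lborel. k s) \<le> \<gamma>"
begin

abbreviation "K \<equiv> K_op mb k"
abbreviation "R \<equiv> I_R k"
abbreviation "J \<equiv> I_Ce mb k"
abbreviation "E \<omega> \<equiv> I_R k (\<lambda>x. exp (\<omega> * x))"
abbreviation "CT \<equiv> {\<phi>::real \<Rightarrow> real. continuous_on {0..T} \<phi>}"

section \<open>Linearity, order and continuity of \<open>K\<close> and \<open>R\<close>\<close>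

lemma \<gamma>_nonneg: "0 \<le> \<gamma>"
proof -
  have "0 \<le> mb T * (LINT s:{0<..<T}|lborel. k s)"
    using tail_kernelD(2)[OF mb] tail_kernelD(2)[OF k]
    by (intro mult_nonneg_nonneg) (auto simp: set_lebesgue_integral_def)
  with mb_le[of T] T_pos show ?thesis by simp
qed

lemma sonine': "0 < x \<Longrightarrow> conv k mb x = 1"
  using sonine by (simp add: conv_commute)

lemma K_eq: "x \<noteq> 0 \<Longrightarrow> K \<phi> x = conv k (\<lambda>r. mb r * \<phi> r) x"
  by (simp add: K_op_def conv_def mult_ac)

lemma K_0 [simp]: "K \<phi> 0 = \<phi> 0"
  by (simp add: K_op_def)

lemma R_0 [simp]: "R \<phi> 0 = 0"
  by (simp add: I_R_def conv_def set_lebesgue_integral_def)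

lemma K_integrable:
  assumes "\<phi> \<in> CT" "x \<le> T"
  shows "set_integrable lborel {0<..<x} (\<lambda>r. k (x - r) * (mb r * \<phi> r))"
proof -
  obtain M where M: "0 \<le> M" "\<And>x. x \<in> {0..T} \<Longrightarrow> \<bar>\<phi> x\<bar> \<le> M"
    using continuous_on_Icc_bounded[of T \<phi>] assms by auto
  show ?thesis
  proof (rule dominated_conv_integrable[OF k mb, where A=1 and B=M])
    show "set_borel_measurable lborel {0<..<x} (\<lambda>r. mb r * \<phi> r)"
      using assms by (intro set_borel_measurable_mult set_borel_measurable_global
        continuous_on_Icc_set_borel_measurable[of T] tail_kernelD(1)[OF mb]) auto
    show "\<bar>mb t * \<phi> t\<bar> \<le> M * mb t" if "0 < t" "t < x" for t
      using M(2)[of t] that assms tail_kernelD(2)[OF mb, of t]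
      by (simp add: abs_mult mult.commute[of M] mult_left_mono)
  qed (auto intro: set_borel_measurable_global tail_kernelD(1)[OF k] simp: tail_kernelD(2)[OF k])
qed

lemma R_integrable:
  assumes "\<phi> \<in> CT" "x \<le> T"
  shows "set_integrable lborel {0<..<x} (\<lambda>t. \<phi> (x - t) * k t)"
proof -
  obtain M where M: "0 \<le> M" "\<And>x. x \<in> {0..T} \<Longrightarrow> \<bar>\<phi> x\<bar> \<le> M"
    using continuous_on_Icc_bounded[of T \<phi>] assms by auto
  show ?thesis
    by (rule dominated_conv_integrable[OF tail_kernel_const[of 1] k, where A=M and B=1])
       (use assms M in \<open>auto intro: set_borel_measurable_global tail_kernelD(1)[OF k]
          continuous_on_Icc_set_borel_measurable[of T] simp: tail_kernelD(2)[OF k]\<close>)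
qed

lemma K_cong:
  assumes "0 \<le> x" "\<And>r. 0 \<le> r \<Longrightarrow> r \<le> x \<Longrightarrow> \<phi> r = \<psi> r"
  shows "K \<phi> x = K \<psi> x"
  using assms by (cases "x = 0") (auto simp: K_eq intro!: conv_cong)

lemma R_cong:
  assumes "0 \<le> x" "\<And>r. 0 \<le> r \<Longrightarrow> r \<le> x \<Longrightarrow> \<phi> r = \<psi> r"
  shows "R \<phi> x = R \<psi> x"
  using assms by (auto simp: I_R_def intro!: conv_cong)

text \<open>The two coefficients cover sums, differences and multiples in one rule; this is why many
  later terms carry factors \<open>1\<close>, \<open>-1\<close> or \<open>0\<close>.\<close>

lemma K_linear:
  assumes "\<phi> \<in> CT" "\<psi> \<in> CT" "x \<in> {0..T}"
  shows "K (\<lambda>r. a * \<phi> r + b * \<psi> r) x = a * K \<phi> x + b * K \<psi> x"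
proof (cases "x = 0")
  case False
  have "conv k (\<lambda>r. mb r * (a * \<phi> r + b * \<psi> r)) x =
      (LINT r:{0<..<x}|lborel. a * (k (x - r) * (mb r * \<phi> r)) + b * (k (x - r) * (mb r * \<psi> r)))"
    unfolding conv_def by (intro set_lebesgue_integral_cong) (auto simp: algebra_simps)
  also have "\<dots> = a * conv k (\<lambda>r. mb r * \<phi> r) x + b * conv k (\<lambda>r. mb r * \<psi> r) x"
    unfolding conv_def using K_integrable[of \<phi> x] K_integrable[of \<psi> x] assms
    by (subst set_integral_add(2)) auto
  finally show ?thesis using False by (simp add: K_eq)
qed simp

lemma R_linear:
  assumes "\<phi> \<in> CT" "\<psi> \<in> CT" "x \<in> {0..T}"
  shows "R (\<lambda>r. a * \<phi> r + b * \<psi> r) x = a * R \<phi> x + b * R \<psi> x"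
proof -
  have "conv (\<lambda>r. a * \<phi> r + b * \<psi> r) k x =
      (LINT r:{0<..<x}|lborel. a * (\<phi> (x - r) * k r) + b * (\<psi> (x - r) * k r))"
    unfolding conv_def by (intro set_lebesgue_integral_cong) (auto simp: algebra_simps)
  also have "\<dots> = a * conv \<phi> k x + b * conv \<psi> k x"
    unfolding conv_def using R_integrable[of \<phi> x] R_integrable[of \<psi> x] assms
    by (subst set_integral_add(2)) auto
  finally show ?thesis by (simp add: I_R_def)
qed

text \<open>The Sonine identity says that the weight \<open>k (x - r) * mb r\<close> has mass 1 on
  (0,x). That constants are fixed by \<open>K\<close> is what leaves the initial value free.\<close>

lemma K_const: "0 \<le> x \<Longrightarrow> K (\<lambda>_. c) x = c"
proof (cases "x = 0")
  case False
  assume "0 \<le> x"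
  have "conv k (\<lambda>r. mb r * c) x = conv k mb x * c"
    unfolding conv_def mult.assoc[symmetric] by simp
  then show ?thesis using False \<open>0 \<le> x\<close> by (simp add: K_eq sonine')
qed simp

lemma K_le:
  assumes "\<phi> \<in> CT" "\<Phi> \<in> CT" "0 < x" "x \<le> T" "\<And>r. 0 < r \<Longrightarrow> r < x \<Longrightarrow> \<bar>\<phi> r\<bar> \<le> \<Phi> r"
  shows "\<bar>K \<phi> x\<bar> \<le> K \<Phi> x"
proof -
  have "\<bar>LINT r:{0<..<x}|lborel. k (x - r) * (mb r * \<phi> r)\<bar> \<le> (LINT r:{0<..<x}|lborel. k (x - r) * (mb r * \<Phi> r))"
    using assms tail_kernelD(2)[OF mb] tail_kernelD(2)[OF k]
    by (intro abs_LINT_le K_integrable) (auto simp: abs_mult intro!: mult_left_mono)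
  then show ?thesis using assms(3) by (simp add: K_eq conv_def)
qed

lemma R_le:
  assumes "\<phi> \<in> CT" "\<Phi> \<in> CT" "0 \<le> x" "x \<le> T" "\<And>r. 0 < r \<Longrightarrow> r < x \<Longrightarrow> \<bar>\<phi> r\<bar> \<le> \<Phi> r"
  shows "\<bar>R \<phi> x\<bar> \<le> R \<Phi> x"
  unfolding I_R_def conv_def
  using assms tail_kernelD(2)[OF k]
  by (intro abs_LINT_le R_integrable) (auto simp: abs_mult intro!: mult_right_mono)

lemma CT_isCont:
  assumes "\<phi> \<in> CT" "0 < t" "t < T"
  shows "isCont \<phi> t"
  using assms by (intro continuous_on_interior[of "{0..T}"]) auto

lemma CT_lin [intro]: "\<phi> \<in> CT \<Longrightarrow> \<psi> \<in> CT \<Longrightarrow> (\<lambda>x. a * \<phi> x + b * \<psi> x) \<in> CT"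
  by (auto intro!: continuous_intros)

text \<open>Continuity at 0 holds because \<open>K \<phi> x - \<phi> 0\<close> is an average of
  \<open>\<phi> r - \<phi> 0\<close> over r < x; on (0,T] it is the continuity of a dominated
  convolution.\<close>

lemma K_CT:
  assumes "\<phi> \<in> CT"
  shows "K \<phi> \<in> CT"
proof -
  obtain M where M: "0 \<le> M" "\<And>x. x \<in> {0..T} \<Longrightarrow> \<bar>\<phi> x\<bar> \<le> M"
    using continuous_on_Icc_bounded[of T \<phi>] assms by auto
  have "continuous_on {0<..T} (conv k (\<lambda>r. mb r * \<phi> r))"
  proof (rule continuous_on_conv[OF k mb _ _ tail_kernel_countable_discontinuities[OF k], where A=1 and B=M])
    show "set_borel_measurable lborel {0<..<T} (\<lambda>r. mb r * \<phi> r)"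
      using assms by (intro set_borel_measurable_mult set_borel_measurable_global
        continuous_on_Icc_set_borel_measurable[of T] tail_kernelD(1)[OF mb]) auto
    show "\<bar>mb t * \<phi> t\<bar> \<le> M * mb t" if "0 < t" "t < T" for t
      using M(2)[of t] that tail_kernelD(2)[OF mb, of t]
      by (simp add: abs_mult mult.commute[of M] mult_left_mono)
    show "isCont (\<lambda>r. mb r * \<phi> r) t" if "0 < t" "t < T" for t
      using that assms by (intro isCont_mult mb_cont CT_isCont)
  qed (auto intro: set_borel_measurable_global tail_kernelD(1)[OF k] simp: tail_kernelD(2)[OF k] M)
  then have "continuous_on {0<..T} (K \<phi>)"
    by (rule continuous_on_eq) (simp add: K_eq)
  moreover have "(K \<phi> \<longlongrightarrow> K \<phi> 0) (at_right 0)"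
  proof (rule tendstoI)
    fix e :: real assume e: "0 < e"
    have "(\<phi> \<longlongrightarrow> \<phi> 0) (at 0 within {0..T})"
      using assms T_pos by (auto simp: continuous_on_def)
    from tendstoD[OF this, of "e/2"] e obtain d where d: "0 < d"
      "\<And>x. x \<in> {0..T} \<Longrightarrow> x \<noteq> 0 \<Longrightarrow> dist x 0 < d \<Longrightarrow> dist (\<phi> x) (\<phi> 0) < e/2"
      by (auto simp: eventually_at)
    have "dist (K \<phi> x) (K \<phi> 0) < e" if x: "0 < x" "x < min d T" for x
    proof -
      have "\<bar>K (\<lambda>r. 1 * \<phi> r + (-1) * \<phi> 0) x\<bar> \<le> K (\<lambda>_. e/2) x"
      proof (rule K_le)
        show "\<bar>1 * \<phi> r + (-1) * \<phi> 0\<bar> \<le> e/2" if "0 < r" "r < x" for r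
          using d(2)[of r] that x by (simp add: dist_real_def)
        show "(\<lambda>r. 1 * \<phi> r + (-1) * \<phi> 0) \<in> CT"
          using assms by (intro CT_lin) auto
      qed (use x in auto)
      moreover have "K (\<lambda>r. 1 * \<phi> r + (-1) * \<phi> 0) x = 1 * K \<phi> x + (-1) * K (\<lambda>_. \<phi> 0) x"
        by (rule K_linear) (use x assms in auto)
      ultimately show ?thesis using x e by (simp add: K_const dist_real_def)
    qed
    then show "\<forall>\<^sub>F x in at_right 0. dist (K \<phi> x) (K \<phi> 0) < e"
      unfolding eventually_at_right_field using d(1) T_pos by (intro exI[of _ "min d T"]) auto
  qed
  ultimately show ?thesis by (auto intro: continuous_on_Icc_of_Ioc)
qed

lemma R_CT:
  assumes "\<phi> \<in> CT"
  shows "R \<phi> \<in> CT"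
proof -
  obtain M where M: "0 \<le> M" "\<And>x. x \<in> {0..T} \<Longrightarrow> \<bar>\<phi> x\<bar> \<le> M"
    using continuous_on_Icc_bounded[of T \<phi>] assms by auto
  have "continuous_on {0<..T} (conv \<phi> k)"
    by (rule continuous_on_conv[OF tail_kernel_const[of 1] k _ _ tail_kernel_countable_discontinuities[OF k], where A=M and B=1])
       (use assms M in \<open>auto intro: set_borel_measurable_global tail_kernelD(1)[OF k] CT_isCont
          continuous_on_Icc_set_borel_measurable[of T] simp: tail_kernelD(2)[OF k]\<close>)
  moreover have "(R \<phi> \<longlongrightarrow> 0) (at_right 0)"
  proof (rule Lim_null_comparison)
    show "((\<lambda>x. M * (LINT t:{0<..<x}|lborel. k t)) \<longlongrightarrow> 0) (at_right 0)"
      using tendsto_mult_left[OF LINT_tendsto_0[OF T_pos tail_kernelD(4)[OF k]], of M] by simp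
    have "norm (R \<phi> x) \<le> M * (LINT t:{0<..<x}|lborel. k t)" if "0 < x" "x < T" for x
    proof -
      have "\<bar>R \<phi> x\<bar> \<le> R (\<lambda>_. M) x"
        using that M assms by (intro R_le) auto
      then show ?thesis by (simp add: I_R_def conv_def)
    qed
    then show "\<forall>\<^sub>F x in at_right 0. norm (R \<phi> x) \<le> M * (LINT t:{0<..<x}|lborel. k t)"
      unfolding eventually_at_right_field using T_pos by (intro exI[of _ T]) auto
  qed
  ultimately show ?thesis
    by (auto intro!: continuous_on_Icc_of_Ioc simp: I_R_def[of k \<phi>, symmetric])
qed

section \<open>Exponential weights and geometric decay of the powers of \<open>K\<close>\<close>

lemma exp_CT: "(\<lambda>x. exp (\<omega> * x)) \<in> CT"
  by (auto intro!: continuous_intros)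

lemma E_nonneg: "0 \<le> E \<omega> x"
  unfolding I_R_def conv_def set_lebesgue_integral_def
  using tail_kernelD(2)[OF k] by (intro Bochner_Integration.integral_nonneg) auto

text \<open>Bounding the exponential under the integral by its value at the right end gives
  \<open>E \<omega> r \<le> exp (\<omega> * r)\<close> times \<kappa>(r), hence
  \<open>mb r * E \<omega> r \<le> \<gamma> * exp (\<omega> * r)\<close>; convolution with
  \<open>k\<close> turns the right-hand side back into a multiple of \<open>E\<close>.\<close>

lemma K_E_le:
  assumes "0 \<le> \<omega>" "0 < x" "x \<le> T"
  shows "K (E \<omega>) x \<le> \<gamma> * E \<omega> x"
proof -
  have "\<bar>K (E \<omega>) x\<bar> \<le> (LINT r:{0<..<x}|lborel. \<gamma> * (k (x - r) * exp (\<omega> * r)))"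
    unfolding K_eq[OF assms(2)[THEN less_imp_neq, symmetric]] conv_def
  proof (rule abs_LINT_le)
    show "set_integrable lborel {0<..<x} (\<lambda>r. k (x - r) * (mb r * E \<omega> r))"
      using assms by (intro K_integrable R_CT exp_CT)
    have "set_integrable lborel {0<..<x} (\<lambda>r. k (x - r) * exp (\<omega> * (x - (x - r))))"
      using R_integrable[OF exp_CT assms(3), of \<omega>]
      by (subst set_integrable_reflect_iff[of _ "\<lambda>r. k r * exp (\<omega> * (x - r))"]) (simp add: mult.commute)
    then show "set_integrable lborel {0<..<x} (\<lambda>r. \<gamma> * (k (x - r) * exp (\<omega> * r)))"
      by simp
    fix r assume "r \<in> {0<..<x}"
    then have r: "0 < r" "r < x" by auto
    have "E \<omega> r \<le> R (\<lambda>_. exp (\<omega> * r)) r"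
    proof (rule order_trans[OF abs_ge_self R_le])
      show "\<bar>exp (\<omega> * t)\<bar> \<le> exp (\<omega> * r)" if "0 < t" "t < r" for t
        using that assms(1) by (simp add: mult_left_mono)
    qed (use r assms exp_CT in auto)
    also have "\<dots> = exp (\<omega> * r) * (LINT s:{0<..<r}|lborel. k s)"
      by (simp add: I_R_def conv_def)
    finally have "mb r * E \<omega> r \<le> mb r * (exp (\<omega> * r) * (LINT s:{0<..<r}|lborel. k s))"
      by (intro mult_left_mono tail_kernelD(2)[OF mb])
    also have "\<dots> = (mb r * (LINT s:{0<..<r}|lborel. k s)) * exp (\<omega> * r)"
      by (simp add: mult_ac)
    also have "\<dots> \<le> \<gamma> * exp (\<omega> * r)"
      using mb_le[of r] r assms by (intro mult_right_mono) auto
    finally have "k (x - r) * (mb r * E \<omega> r) \<le> k (x - r) * (\<gamma> * exp (\<omega> * r))"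
      by (intro mult_left_mono tail_kernelD(2)[OF k])
    moreover have "0 \<le> k (x - r) * (mb r * E \<omega> r)"
      by (intro mult_nonneg_nonneg tail_kernelD(2)[OF k] tail_kernelD(2)[OF mb] E_nonneg)
    ultimately show "\<bar>k (x - r) * (mb r * E \<omega> r)\<bar> \<le> \<gamma> * (k (x - r) * exp (\<omega> * r))"
      by (simp add: mult_ac)
  qed
  also have "\<dots> = \<gamma> * conv k (\<lambda>x. exp (\<omega> * x)) x"
    by (simp add: conv_def)
  finally show ?thesis by (simp add: I_R_def conv_commute[of k])
qed

lemma K_funpow:
  assumes g: "g \<in> CT" and \<omega>: "0 \<le> \<omega>" and le: "\<And>x. x \<in> {0..T} \<Longrightarrow> \<bar>g x\<bar> \<le> A * exp (\<omega> * x)"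
  shows "(K ^^ i) (R g) \<in> CT" "x \<in> {0..T} \<Longrightarrow> \<bar>(K ^^ i) (R g) x\<bar> \<le> A * \<gamma> ^ i * E \<omega> x"
proof -
  have A: "0 \<le> A" using le[of 0] T_pos by (simp add: order_trans[OF abs_ge_zero])
  have "(K ^^ i) (R g) \<in> CT \<and> (\<forall>x\<in>{0..T}. \<bar>(K ^^ i) (R g) x\<bar> \<le> A * \<gamma> ^ i * E \<omega> x)"
  proof (induction i)
    case 0
    have "\<bar>R g x\<bar> \<le> A * E \<omega> x" if "x \<in> {0..T}" for x
    proof -
      have "\<bar>R g x\<bar> \<le> R (\<lambda>x. A * exp (\<omega> * x) + 0 * exp (\<omega> * x)) x"
        using that le g by (intro R_le CT_lin exp_CT) auto
      also have "\<dots> = A * E \<omega> x + 0 * E \<omega> x"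
        using that by (intro R_linear exp_CT) auto
      finally show ?thesis by simp
    qed
    then show ?case using R_CT[OF g] by simp
  next
    case (Suc i)
    have "\<bar>K ((K ^^ i) (R g)) x\<bar> \<le> A * \<gamma> ^ Suc i * E \<omega> x" if "x \<in> {0..T}" for x
    proof (cases "x = 0")
      case True
      \<comment> \<open>At 0 the operator \<open>K\<close> reproduces the value instead of
        contracting it, but both sides of the bound vanish there because
        \<open>E \<omega> 0 = 0\<close>.\<close>
      then show ?thesis using bspec[OF Suc[THEN conjunct2], of 0] T_pos by simp
    next
      case False
      have "\<bar>K ((K ^^ i) (R g)) x\<bar> \<le> K (\<lambda>x. (A * \<gamma> ^ i) * E \<omega> x + 0 * E \<omega> x) x"
        using that False Suc by (intro K_le CT_lin R_CT exp_CT) auto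
      also have "\<dots> = (A * \<gamma> ^ i) * K (E \<omega>) x + 0 * K (E \<omega>) x"
        using that by (intro K_linear R_CT exp_CT) auto
      also have "\<dots> \<le> (A * \<gamma> ^ i) * (\<gamma> * E \<omega> x)"
        using K_E_le[OF \<omega>, of x] that False A \<gamma>_nonneg by (simp add: mult_left_mono)
      finally show ?thesis by (simp add: mult_ac)
    qed
    then show ?case using K_CT Suc by simp
  qed
  then show "(K ^^ i) (R g) \<in> CT" "x \<in> {0..T} \<Longrightarrow> \<bar>(K ^^ i) (R g) x\<bar> \<le> A * \<gamma> ^ i * E \<omega> x"
    by auto
qed

text \<open>Averages do not increase the sup norm; this carries \<open>K\<close> through the uniform
  limit of the series.\<close>

lemma K_diff_le:
  assumes "\<phi> \<in> CT" "\<psi> \<in> CT" "x \<in> {0..T}" "\<And>r. r \<in> {0..T} \<Longrightarrow> \<bar>\<phi> r - \<psi> r\<bar> \<le> e"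
  shows "\<bar>K \<phi> x - K \<psi> x\<bar> \<le> e"
proof (cases "x = 0")
  case False
  have "\<bar>K (\<lambda>r. 1 * \<phi> r + (-1) * \<psi> r) x\<bar> \<le> K (\<lambda>_. e) x"
    using assms False by (intro K_le CT_lin) auto
  then show ?thesis
    using assms K_linear[of \<phi> \<psi> x 1 "-1"] by (simp add: K_const)
qed (use assms in auto)

lemma exp_bound:
  assumes "g \<in> CT" "0 \<le> \<omega>"
  obtains A where "0 \<le> A" "\<And>x. x \<in> {0..T} \<Longrightarrow> \<bar>g x\<bar> \<le> A * exp (\<omega> * x)"
proof -
  obtain M where M: "0 \<le> M" "\<And>x. x \<in> {0..T} \<Longrightarrow> \<bar>g x\<bar> \<le> M"
    using continuous_on_Icc_bounded[of T g] assms by auto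
  show thesis
  proof (rule that[OF M(1)])
    fix x assume x: "x \<in> {0..T}"
    then have "M * 1 \<le> M * exp (\<omega> * x)"
      using assms(2) M(1) by (intro mult_left_mono) auto
    with M(2)[OF x] show "\<bar>g x\<bar> \<le> M * exp (\<omega> * x)" by simp
  qed
qed

text \<open>The weight \<omega> = 0 already suffices for convergence: the terms are bounded by a
  constant multiple of \<gamma>^i. Uniformity is what makes the sum continuous.\<close>

lemma J_uniform_limit:
  assumes g: "g \<in> CT"
  shows "uniform_limit {0..T} (\<lambda>n x. \<Sum>i<n. (K ^^ i) (R g) x) (J g) sequentially"
proof -
  obtain A where A: "0 \<le> A" "\<And>x. x \<in> {0..T} \<Longrightarrow> \<bar>g x\<bar> \<le> A * exp (0 * x)"
    using exp_bound[OF g, of 0] by auto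
  from R_CT[OF exp_CT, of 0] have "continuous_on {0..T} (E 0)" by (rule CollectD)
  then obtain M where M: "0 \<le> M" "\<And>x. x \<in> {0..T} \<Longrightarrow> \<bar>E 0 x\<bar> \<le> M"
    by (rule continuous_on_Icc_bounded) (rule that)
  have "norm ((K ^^ i) (R g) x) \<le> (A * M) * \<gamma> ^ i" if "x \<in> {0..T}" for x i
  proof -
    have "\<bar>(K ^^ i) (R g) x\<bar> \<le> A * \<gamma> ^ i * E 0 x"
      by (rule K_funpow(2)[OF g _ A(2)]) (use that in auto)
    also have "\<dots> \<le> A * \<gamma> ^ i * M"
      using A M(2)[OF that] \<gamma>_nonneg by (intro mult_left_mono) auto
    finally show ?thesis by (simp add: mult_ac)
  qed
  moreover have "summable (\<lambda>i. (A * M) * \<gamma> ^ i)"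
    using \<gamma>_nonneg \<gamma>_less_1 by (intro summable_mult summable_geometric) auto
  ultimately have "uniform_limit {0..T} (\<lambda>n x. \<Sum>i<n. (K ^^ i) (R g) x) (\<lambda>x. \<Sum>i. (K ^^ i) (R g) x) sequentially"
    by (rule Weierstrass_m_test)
  then show ?thesis by (simp add: I_Ce_def[abs_def])
qed

lemma K_funpow_CT: "g \<in> CT \<Longrightarrow> (K ^^ i) (R g) \<in> CT"
  by (induction i) (auto simp: R_CT[simplified] K_CT[simplified])

lemma J_partial_CT: "g \<in> CT \<Longrightarrow> (\<lambda>x. \<Sum>i<n. (K ^^ i) (R g) x) \<in> CT"
  using K_funpow_CT by (auto intro!: continuous_on_sum)

lemma J_CT: "g \<in> CT \<Longrightarrow> J g \<in> CT"
  using uniform_limit_theorem[OF _ J_uniform_limit] J_partial_CT by auto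

lemma J_LIMSEQ: "g \<in> CT \<Longrightarrow> x \<in> {0..T} \<Longrightarrow> (\<lambda>n. \<Sum>i<n. (K ^^ i) (R g) x) \<longlonglongrightarrow> J g x"
  using tendsto_uniform_limitI[OF J_uniform_limit] by blast

text \<open>\<open>K\<close> shifts partial sums: it maps each one to the next one minus the leading
  term \<open>R g\<close>. The identity survives in the limit.\<close>

lemma J_eq:
  assumes g: "g \<in> CT" and x: "x \<in> {0..T}"
  shows "J g x = R g x + K (J g) x"
proof -
  let ?S = "\<lambda>n x. \<Sum>i<n. (K ^^ i) (R g) x"
  have KS: "K (?S n) x = ?S (Suc n) x - R g x" for n
  proof (induction n)
    case 0
    show ?case using x K_const[of x 0] by simp
  next
    case (Suc n)
    have "K (\<lambda>x. 1 * ?S n x + 1 * (K ^^ n) (R g) x) x = 1 * K (?S n) x + 1 * K ((K ^^ n) (R g)) x"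
      by (intro K_linear J_partial_CT K_funpow_CT g x)
    then show ?case using Suc by simp
  qed
  have "(\<lambda>n. K (?S n) x) \<longlonglongrightarrow> K (J g) x"
    by (rule tendsto_of_uniform_limit[OF J_uniform_limit[OF g], of 1])
       (auto intro!: K_diff_le[OF J_partial_CT[OF g] J_CT[OF g] x])
  moreover have "(\<lambda>n. ?S (Suc n) x - R g x) \<longlonglongrightarrow> J g x - R g x"
    by (intro tendsto_diff tendsto_const LIMSEQ_Suc[OF J_LIMSEQ[OF g x]])
  ultimately show ?thesis
    unfolding KS using LIMSEQ_unique by fastforce
qed

lemma J_le:
  assumes g: "g \<in> CT" and \<omega>: "0 \<le> \<omega>" and le: "\<And>x. x \<in> {0..T} \<Longrightarrow> \<bar>g x\<bar> \<le> A * exp (\<omega> * x)"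
    and x: "x \<in> {0..T}"
  shows "\<bar>J g x\<bar> \<le> A * (E \<omega> x / (1 - \<gamma>))"
proof -
  have "(\<lambda>i. \<gamma> ^ i) sums (1 / (1 - \<gamma>))"
    using \<gamma>_nonneg \<gamma>_less_1 by (intro geometric_sums) auto
  from sums_mult[OF this, of "A * E \<omega> x"]
  have s: "(\<lambda>i. A * \<gamma> ^ i * E \<omega> x) sums (A * (E \<omega> x / (1 - \<gamma>)))"
    by (simp add: mult_ac)
  have "norm (J g x) \<le> (\<Sum>i. A * \<gamma> ^ i * E \<omega> x)"
    unfolding I_Ce_def
    using K_funpow(2)[OF g \<omega> le x] sums_summable[OF s] by (intro norm_suminf_le) auto
  then show ?thesis using sums_unique[OF s] by simp
qed

lemma K_funpow_linear:
  assumes "g \<in> CT" "h \<in> CT" "x \<in> {0..T}"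
  shows "(K ^^ i) (R (\<lambda>r. a * g r + b * h r)) x = a * (K ^^ i) (R g) x + b * (K ^^ i) (R h) x"
  using assms(3)
proof (induction i arbitrary: x)
  case (Suc i)
  have "(K ^^ Suc i) (R (\<lambda>r. a * g r + b * h r)) x = K (\<lambda>r. a * (K ^^ i) (R g) r + b * (K ^^ i) (R h) r) x"
    using Suc by (auto intro!: K_cong)
  then show ?case
    using K_linear[OF K_funpow_CT K_funpow_CT, OF assms(1,2) Suc.prems] by simp
qed (use R_linear[OF assms(1,2)] in simp)

lemma J_linear:
  assumes "g \<in> CT" "h \<in> CT" "x \<in> {0..T}"
  shows "J (\<lambda>r. a * g r + b * h r) x = a * J g x + b * J h x"
proof (rule LIMSEQ_unique[OF J_LIMSEQ])
  have "(\<lambda>n. a * (\<Sum>i<n. (K ^^ i) (R g) x) + b * (\<Sum>i<n. (K ^^ i) (R h) x)) \<longlonglongrightarrow> a * J g x + b * J h x"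
    by (intro tendsto_intros J_LIMSEQ assms)
  then show "(\<lambda>n. \<Sum>i<n. (K ^^ i) (R (\<lambda>r. a * g r + b * h r)) x) \<longlonglongrightarrow> a * J g x + b * J h x"
    by (simp add: K_funpow_linear[OF assms] sum.distrib sum_distrib_left)
qed (use assms CT_lin in auto)

text \<open>Functions are total, but identities between them hold on [0,T] only; the iterates at x
  look at no values outside [0,x].\<close>

lemma J_cong:
  assumes "\<And>r. r \<in> {0..T} \<Longrightarrow> g r = h r" "x \<in> {0..T}"
  shows "J g x = J h x"
proof -
  have "(K ^^ i) (R g) x = (K ^^ i) (R h) x" for i
    using assms(2)
  proof (induction i arbitrary: x)
    case 0
    then show ?case using assms(1) by (auto intro!: R_cong)
  next
    case (Suc i)
    then show ?case by (auto intro!: K_cong)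
  qed
  then show ?thesis by (simp add: I_Ce_def)
qed

lemma J_0 [simp]: "J g 0 = 0"
proof -
  have "(K ^^ i) (R g) 0 = 0" for i by (induction i) auto
  then show ?thesis by (simp add: I_Ce_def)
qed

text \<open>
  \<open>K\<close> averages against a probability density on \<open>(0,x)\<close>, so a fixed point attains the first
  maximum of its modulus only at \<open>0\<close>.
\<close>

lemma K_fixed_point_eq_0:
  assumes w: "w \<in> CT" and w0: "w 0 = 0" and fix_w: "\<And>x. 0 < x \<Longrightarrow> x \<le> T \<Longrightarrow> w x = K w x"
    and y: "y \<in> {0..T}"
  shows "w y = 0"
proof (rule ccontr)
  assume "w y \<noteq> 0"
  have cw: "continuous_on {0..T} (\<lambda>x. \<bar>w x\<bar>)" using w by (auto intro: continuous_intros)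
  obtain z where z: "z \<in> {0..T}" "\<And>x. x \<in> {0..T} \<Longrightarrow> \<bar>w x\<bar> \<le> \<bar>w z\<bar>"
    using continuous_attains_sup[OF compact_Icc _ cw] y by blast
  define M where "M = \<bar>w z\<bar>"
  have M: "0 < M" "\<And>x. x \<in> {0..T} \<Longrightarrow> \<bar>w x\<bar> \<le> M"
    using z(2)[OF y] z(2) \<open>w y \<noteq> 0\<close> by (simp_all add: M_def)
  \<comment> \<open>The leftmost point of this level set is the first maximum of the modulus, which
    is strictly smaller everywhere to its left.\<close>
  define S where "S = {0..T} \<inter> (\<lambda>x. \<bar>w x\<bar>) -` {M}"
  have "closed S"
    unfolding S_def by (rule continuous_closed_preimage[OF cw]) auto
  then have "compact S"
    unfolding compact_eq_bounded_closed by (auto intro: bounded_subset[of "{0..T}"] simp: S_def)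
  moreover have "z \<in> S" using z by (simp add: S_def M_def)
  ultimately obtain x where x: "x \<in> S" "\<And>t. t \<in> S \<Longrightarrow> x \<le> t"
    using compact_attains_inf[of S] by blast
  have x0: "0 < x" "x \<le> T" "\<bar>w x\<bar> = M"
    using x(1) M(1) w0 by (auto simp: S_def less_le)
  have less: "\<bar>w r\<bar> < M" if "0 < r" "r < x" for r
    using that x(2)[of r] M(2)[of r] x0(2) by (auto simp: S_def less_le)
  have aw: "(\<lambda>x. \<bar>w x\<bar>) \<in> CT" using cw by simp
  \<comment> \<open>This gap is positive on (0,x), yet its average at x is at most 0, because w(x)
    is itself the average of w.\<close>
  let ?d = "\<lambda>r. 1 * M + (-1) * \<bar>w r\<bar>"
  have d: "?d \<in> CT" using aw by (intro CT_lin) auto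
  have "K ?d x = 1 * K (\<lambda>_. M) x + (-1) * K (\<lambda>x. \<bar>w x\<bar>) x"
    by (rule K_linear) (use aw x0 in auto)
  also have "\<dots> = M - K (\<lambda>x. \<bar>w x\<bar>) x" using x0 by (simp add: K_const)
  also have "\<dots> \<le> 0"
    using K_le[OF w aw x0(1,2)] fix_w[OF x0(1,2)] x0(3) by simp
  finally have le: "(\<integral>r. indicator {0<..<x} r *\<^sub>R (k (x - r) * (mb r * ?d r)) \<partial>lborel) \<le> 0"
    using x0 by (simp add: K_eq conv_def set_lebesgue_integral_def)
  have int: "integrable lborel (\<lambda>r. indicator {0<..<x} r *\<^sub>R (k (x - r) * (mb r * ?d r)))"
    using K_integrable[OF d x0(2)] by (simp only: set_integrable_def)
  have nn: "0 \<le> indicator {0<..<x} r *\<^sub>R (k (x - r) * (mb r * ?d r))" for r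
    using less[of r] tail_kernelD(2)[OF k] tail_kernelD(2)[OF mb] by (auto simp: indicator_def)
  have "(\<integral>r. indicator {0<..<x} r *\<^sub>R (k (x - r) * (mb r * ?d r)) \<partial>lborel) = 0"
    using le nn by (intro antisym Bochner_Integration.integral_nonneg) auto
  then have "AE r in lborel. indicator {0<..<x} r *\<^sub>R (k (x - r) * (mb r * ?d r)) = 0"
    using integral_nonneg_eq_0_iff_AE[OF int] nn by auto
  \<comment> \<open>A positive gap integrates to 0 only if the averaging weight vanishes almost
    everywhere, against its mass 1.\<close>
  then have "AE r in lborel. indicator {0<..<x} r *\<^sub>R (k (x - r) * mb r) = 0"
    by eventually_elim (use less in \<open>force simp: indicator_def\<close>)
  then have "conv k mb x = 0"
    unfolding conv_def set_lebesgue_integral_def by (rule integral_eq_zero_AE)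
  then show False using sonine'[OF x0(1)] by simp
qed

text \<open>The difference of \<phi> and \<open>\<phi> 0 + J G\<close> is fixed by \<open>K\<close>,
  since \<open>J G\<close> solves the same equation and constants are fixed, and it vanishes at
  0.\<close>

lemma J_unique:
  assumes \<phi>: "\<phi> \<in> CT" and G: "G \<in> CT"
    and eq: "\<And>x. 0 < x \<Longrightarrow> x \<le> T \<Longrightarrow> \<phi> x = K \<phi> x + R G x" and x: "x \<in> {0..T}"
  shows "\<phi> x = \<phi> 0 + J G x"
proof -
  let ?\<psi> = "\<lambda>x. 1 * \<phi> 0 + 1 * J G x"
  have \<psi>: "?\<psi> \<in> CT" by (intro CT_lin J_CT G) auto
  have "1 * \<phi> x + (-1) * ?\<psi> x = 0"
  proof (rule K_fixed_point_eq_0[of "\<lambda>x. 1 * \<phi> x + (-1) * ?\<psi> x", OF CT_lin[OF \<phi> \<psi>] _ _ x])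
    fix y assume y: "0 < y" "y \<le> T"
    have "K ?\<psi> y = 1 * K (\<lambda>_. \<phi> 0) y + 1 * K (J G) y"
      by (rule K_linear) (use y J_CT[OF G] in auto)
    moreover have "K (\<lambda>x. 1 * \<phi> x + (-1) * ?\<psi> x) y = 1 * K \<phi> y + (-1) * K ?\<psi> y"
      by (rule K_linear[OF \<phi> \<psi>]) (use y in auto)
    ultimately show "1 * \<phi> y + (-1) * ?\<psi> y = K (\<lambda>x. 1 * \<phi> x + (-1) * ?\<psi> x) y"
      using eq[OF y] J_eq[OF G, of y] y by (simp add: K_const)
  qed simp
  then show ?thesis by simp
qed

section \<open>Equivalence of the censored equation and the fixed point equation\<close>

lemma kernel_integrable:
  assumes "\<phi> \<in> CT"
  shows "set_integrable lborel {0<..<T} (\<lambda>r. mb r * \<phi> r)"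
proof -
  obtain M where M: "0 \<le> M" "\<And>x. x \<in> {0..T} \<Longrightarrow> \<bar>\<phi> x\<bar> \<le> M"
    using continuous_on_Icc_bounded[of T \<phi>] assms by auto
  have "set_integrable lborel {0<..<T} (\<lambda>t. 1 * (mb t * \<phi> t))"
  proof (rule dominated_conv_integrable[OF tail_kernel_const[of 1] mb, where A=1 and B=M])
    show "set_borel_measurable lborel {0<..<T} (\<lambda>r. mb r * \<phi> r)"
      using assms by (intro set_borel_measurable_mult set_borel_measurable_global
        continuous_on_Icc_set_borel_measurable[of T] tail_kernelD(1)[OF mb]) auto
    show "\<bar>mb t * \<phi> t\<bar> \<le> M * mb t" if "0 < t" "t < T" for t
      using M(2)[of t] that tail_kernelD(2)[OF mb, of t]
      by (simp add: abs_mult mult.commute[of M] mult_left_mono)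
  qed (auto intro: set_borel_measurable_global)
  then show ?thesis by simp
qed

lemma CT_integrable: "\<phi> \<in> CT \<Longrightarrow> set_integrable lborel {0<..<T} \<phi>"
  by (rule set_integrable_subset[OF borel_integrable_atLeastAtMost'[of 0 T]]) auto

lemma source_integrable:
  assumes "\<phi> \<in> CT" "G \<in> CT"
  shows "set_integrable lborel {0<..<T} (\<lambda>r. mb r * \<phi> r + G r)"
  by (intro set_integral_add(1) kernel_integrable CT_integrable assms)

lemma source_continuous:
  assumes "\<phi> \<in> CT" "G \<in> CT"
  shows "continuous_on {0<..T} (\<lambda>r. mb r * \<phi> r + G r)"
proof -
  have "continuous_on {0<..T} mb"
    using mb_cont by (intro continuous_at_imp_continuous_on) auto
  moreover have "continuous_on {0<..T} \<phi>" "continuous_on {0<..T} G"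
    by (rule continuous_on_subset[of "{0..T}"]; use assms in auto)+
  ultimately show ?thesis by (intro continuous_intros)
qed

text \<open>Reading the right-hand side of the fixed point equation as a single convolution of
  \<open>k\<close> with the source \<open>mb r * \<phi> r + G r\<close> is what lets the Sonine
  identity invert it.\<close>

lemma conv_source:
  assumes "\<phi> \<in> CT" "G \<in> CT" "0 < x" "x \<le> T"
  shows "conv k (\<lambda>r. mb r * \<phi> r + G r) x = K \<phi> x + R G x"
proof -
  have "set_integrable lborel {0<..<x} (\<lambda>t. k (x - t) * G (x - (x - t)))"
    using R_integrable[OF assms(2,4)]
    by (subst set_integrable_reflect_iff[of _ "\<lambda>t. k t * G (x - t)"]) (simp add: mult.commute)
  then have G: "set_integrable lborel {0<..<x} (\<lambda>t. k (x - t) * G t)" by simp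
  have "R G x = conv k G x" unfolding I_R_def by (rule conv_commute)
  then show ?thesis
    using assms(3) K_integrable[OF assms(1,4)] G
    by (simp add: K_eq conv_def ring_distribs)
qed

lemma conv_eq_LINT:
  assumes \<phi>: "\<phi> \<in> CT" and G: "G \<in> CT" and eq: "\<And>x. 0 < x \<Longrightarrow> x \<le> T \<Longrightarrow> \<phi> x = K \<phi> x + R G x"
    and x: "0 < x" "x \<le> T"
  shows "conv mb \<phi> x = (LINT r:{0<..<x}|lborel. mb r * \<phi> r + G r)"
proof -
  have "conv mb \<phi> x = conv mb (conv k (\<lambda>r. mb r * \<phi> r + G r)) x"
    using x eq conv_source[OF \<phi> G] by (intro conv_cong) auto
  also have "\<dots> = (LINT r:{0<..<x}|lborel. mb r * \<phi> r + G r)"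
    by (intro conv_conv_of_conv_eq_1[OF mb k sonine] set_integrable_subset[OF source_integrable[OF \<phi> G]])
       (use x in auto)
  finally show ?thesis .
qed

text \<open>Both sides of the claim have the same convolution with \<open>mb\<close>, and this
  convolution is injective on continuous functions: one more convolution with \<open>k\<close> turns
  it into integration from 0, and differentiating the primitives recovers the values.\<close>

lemma eq_of_conv_eq_LINT:
  assumes \<phi>: "\<phi> \<in> CT" and G: "G \<in> CT"
    and eq: "\<And>x. 0 < x \<Longrightarrow> x \<le> T \<Longrightarrow> conv mb \<phi> x = (LINT r:{0<..<x}|lborel. mb r * \<phi> r + G r)"
    and x: "0 < x" "x \<le> T"
  shows "\<phi> x = K \<phi> x + R G x"
proof -
  let ?H = "\<lambda>r. mb r * \<phi> r + G r" and ?\<psi> = "\<lambda>x. 1 * K \<phi> x + 1 * R G x"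
  have \<psi>: "?\<psi> \<in> CT" by (intro CT_lin K_CT R_CT \<phi> G)
  have same: "(LINT r:{0<..<y}|lborel. \<phi> r) = (LINT r:{0<..<y}|lborel. ?\<psi> r)" if y: "y \<in> {0<..T}" for y
  proof -
    have int: "set_integrable lborel {0<..<y} h" if "h \<in> CT" for h
      by (rule set_integrable_subset[OF CT_integrable[OF that]]) (use y in auto)
    have c: "conv mb (conv k ?H) t = (LINT r:{0<..<t}|lborel. ?H r)" if "0 < t" "t \<le> T" for t
      by (intro conv_conv_of_conv_eq_1[OF mb k sonine] set_integrable_subset[OF source_integrable[OF \<phi> G]])
         (use that in auto)
    have "(LINT r:{0<..<y}|lborel. \<phi> r) = conv k (conv mb \<phi>) y"
      by (rule conv_conv_of_conv_eq_1[OF k mb sonine' int[OF \<phi>], symmetric])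
    also have "\<dots> = conv k (conv mb ?\<psi>) y"
    proof (rule conv_cong)
      fix t assume t: "0 < t" "t < y"
      have "conv mb ?\<psi> t = conv mb (conv k ?H) t"
        by (rule conv_cong) (use t y conv_source[OF \<phi> G] in auto)
      then show "conv mb \<phi> t = conv mb ?\<psi> t" using c eq t y by simp
    qed simp
    also have "\<dots> = (LINT r:{0<..<y}|lborel. ?\<psi> r)"
      by (rule conv_conv_of_conv_eq_1[OF k mb sonine' int[OF \<psi>]])
    finally show ?thesis .
  qed
  have x': "x \<in> {0<..T}" using x by simp
  have c: "continuous_on {0<..T} \<phi>" "continuous_on {0<..T} ?\<psi>"
    by (rule continuous_on_subset[of "{0..T}"]; use \<phi> \<psi> in auto)+
  have "((\<lambda>y. LINT r:{0<..<y}|lborel. ?\<psi> r) has_vector_derivative \<phi> x) (at x within {0<..T})"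
    by (rule has_vector_derivative_transform[OF x' same[symmetric]
          has_vector_derivative_LINT[OF c(1) CT_integrable[OF \<phi>] x']])
  moreover have "((\<lambda>y. LINT r:{0<..<y}|lborel. ?\<psi> r) has_vector_derivative ?\<psi> x) (at x within {0<..T})"
    by (rule has_vector_derivative_LINT[OF c(2) CT_integrable[OF \<psi>] x'])
  ultimately show ?thesis
    using vector_derivative_unique_within[OF at_within_Ioc_neq_bot[OF x']] by fastforce
qed

text \<open>The derivative of \<open>conv mb \<phi>\<close> comes out as
  \<open>mb x * \<phi> x + G x\<close>, whose first summand is exactly the term that the censored
  derivative subtracts.\<close>

lemma censored_deriv_of_eq:
  assumes \<phi>: "\<phi> \<in> CT" and G: "G \<in> CT" and eq: "\<And>x. 0 < x \<Longrightarrow> x \<le> T \<Longrightarrow> \<phi> x = K \<phi> x + R G x"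
  shows "\<phi> \<in> C_Icc mb T" "x \<in> {0<..T} \<Longrightarrow> censored_deriv mb T \<phi> x = G x"
proof -
  have der: "(conv mb \<phi> has_vector_derivative mb x * \<phi> x + G x) (at x within {0<..T})" if "x \<in> {0<..T}" for x
    by (rule has_vector_derivative_transform[OF that _
          has_vector_derivative_LINT[OF source_continuous[OF \<phi> G] source_integrable[OF \<phi> G] that]])
       (use conv_eq_LINT[OF \<phi> G eq] in auto)
  then have "C1_Ioc T (conv mb \<phi>)"
    unfolding C1_Ioc_def using source_continuous[OF \<phi> G] by (intro exI[of _ "\<lambda>x. mb x * \<phi> x + G x"]) auto
  then show "\<phi> \<in> C_Icc mb T"
    using \<phi> CT_integrable[OF \<phi>] by (auto simp: C_Icc_def C_Ioc_def intro: continuous_on_subset)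
  show "censored_deriv mb T \<phi> x = G x" if "x \<in> {0<..T}"
  proof -
    \<comment> \<open>The domain is stated with \<open>conv mb \<phi>\<close>, the derivative with
      \<open>conv \<phi> mb\<close>.\<close>
    have "conv \<phi> mb = conv mb \<phi>" by (intro ext conv_commute)
    then show ?thesis
      using vector_derivative_within[OF at_within_Ioc_neq_bot[OF that] der[OF that]]
      by (simp add: censored_deriv_def mult.commute)
  qed
qed

text \<open>The equation determines \<open>conv mb \<phi>\<close> only up to a constant. Boundedness
  of \<phi> makes this convolution tend to 0 at 0, as does the primitive of the source, so the
  constant is 0.\<close>

lemma eq_of_censored_deriv:
  assumes \<phi>: "\<phi> \<in> C_Icc mb T" and G: "G \<in> CT"
    and deriv: "\<And>x. x \<in> {0<..T} \<Longrightarrow> censored_deriv mb T \<phi> x = G x"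
    and x: "0 < x" "x \<le> T"
  shows "\<phi> x = K \<phi> x + R G x"
proof (rule eq_of_conv_eq_LINT[OF _ G _ x])
  show CT: "\<phi> \<in> CT" using \<phi> by (auto simp: C_Icc_def)
  let ?I = "\<lambda>y. LINT r:{0<..<y}|lborel. mb r * \<phi> r + G r"
  obtain F' where F': "\<And>x. x \<in> {0<..T} \<Longrightarrow> (conv mb \<phi> has_vector_derivative F' x) (at x within {0<..T})"
    using \<phi> unfolding C_Icc_def C_Ioc_def C1_Ioc_def by blast
  have der0: "((\<lambda>x. conv mb \<phi> x - ?I x) has_vector_derivative 0) (at x within {0<..T})" if x: "x \<in> {0<..T}" for x
  proof -
    have "conv \<phi> mb = conv mb \<phi>" by (intro ext conv_commute)
    then have "F' x = mb x * \<phi> x + G x"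
      using deriv[OF x] vector_derivative_within[OF at_within_Ioc_neq_bot[OF x] F'[OF x]]
      by (simp add: censored_deriv_def mult.commute)
    then show ?thesis
      using has_vector_derivative_diff[OF F'[OF x]
          has_vector_derivative_LINT[OF source_continuous[OF CT G] source_integrable[OF CT G] x]] by simp
  qed
  obtain c where c: "\<And>x. x \<in> {0<..T} \<Longrightarrow> conv mb \<phi> x - ?I x = c"
    using has_vector_derivative_zero_constant[OF _ der0] by (auto simp: convex_real_interval)
  obtain M where M: "0 \<le> M" "\<And>x. x \<in> {0..T} \<Longrightarrow> \<bar>\<phi> x\<bar> \<le> M"
    using continuous_on_Icc_bounded[of T \<phi>] CT by auto
  have "(conv mb \<phi> \<longlongrightarrow> 0) (at_right 0)"
  proof (rule Lim_null_comparison)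
    show "((\<lambda>x. M * (LINT t:{0<..<x}|lborel. mb t)) \<longlongrightarrow> 0) (at_right 0)"
      using tendsto_mult_left[OF LINT_tendsto_0[OF T_pos tail_kernelD(4)[OF mb]], of M] by simp
    have "norm (conv mb \<phi> y) \<le> M * (LINT t:{0<..<y}|lborel. mb t)" if y: "0 < y" "y < T" for y
    proof -
      have "\<bar>LINT t:{0<..<y}|lborel. \<phi> (y - t) * mb t\<bar> \<le> (LINT t:{0<..<y}|lborel. M * mb t)"
      proof (rule abs_LINT_le)
        show "set_integrable lborel {0<..<y} (\<lambda>t. \<phi> (y - t) * mb t)"
          by (rule dominated_conv_integrable[OF tail_kernel_const[of 1] mb, where A=M and B=1])
             (use CT M y in \<open>auto intro: set_borel_measurable_global tail_kernelD(1)[OF mb]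
               continuous_on_Icc_set_borel_measurable[of T] simp: tail_kernelD(2)[OF mb]\<close>)
        show "\<bar>\<phi> (y - t) * mb t\<bar> \<le> M * mb t" if "t \<in> {0<..<y}" for t
          using that y M(2)[of "y - t"] tail_kernelD(2)[OF mb, of t]
          by (simp add: abs_mult mult_right_mono)
      qed (simp add: tail_kernelD(4)[OF mb])
      moreover have "conv mb \<phi> y = conv \<phi> mb y" by (rule conv_commute)
      ultimately show ?thesis by (simp add: conv_def)
    qed
    then show "\<forall>\<^sub>F y in at_right 0. norm (conv mb \<phi> y) \<le> M * (LINT t:{0<..<y}|lborel. mb t)"
      unfolding eventually_at_right_field using T_pos by (intro exI[of _ T]) auto
  qed
  from tendsto_diff[OF this LINT_tendsto_0[OF T_pos source_integrable[OF CT G]]]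
  have "((\<lambda>x. conv mb \<phi> x - ?I x) \<longlongrightarrow> 0) (at_right 0)" by simp
  moreover have "\<forall>\<^sub>F x in at_right 0. conv mb \<phi> x - ?I x = c"
    unfolding eventually_at_right_field using T_pos by (intro exI[of _ T]) (auto simp: c)
  ultimately have "((\<lambda>_. c) \<longlongrightarrow> 0) (at_right (0::real))"
    by (rule Lim_transform_eventually)
  then have "c = 0" by (simp add: tendsto_const_iff)
  then show "conv mb \<phi> y = ?I y" if "0 < y" "y \<le> T" for y
    using c[of y] that by simp
qed

section \<open>Exponential damping of \<open>k\<close> on (0,T)\<close>

definition laplace_k :: "real \<Rightarrow> real" where
  "laplace_k \<omega> = (LINT t:{0<..<T}|lborel. exp (- \<omega> * t) * k t)"

lemma damped_k_integrable:
  assumes "0 \<le> \<omega>"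
  shows "set_integrable lborel {0<..<x} (\<lambda>t. exp (- \<omega> * t) * k t)"
proof (rule set_integrable_bound[OF tail_kernelD(4)[OF k]])
  show "set_borel_measurable lborel {0<..<x} (\<lambda>t. exp (- \<omega> * t) * k t)"
    using tail_kernelD(1)[OF k] by (intro set_borel_measurable_global) measurable
  show "AE t in lborel. t \<in> {0<..<x} \<longrightarrow> norm (exp (- \<omega> * t) * k t) \<le> norm (k t)"
    using assms tail_kernelD(2)[OF k]
    by (intro AE_I2) (auto simp: abs_mult intro!: mult_left_le_one_le)
qed

text \<open>\<open>exp (\<omega> * (x - t))\<close> splits into the weight
  \<open>exp (\<omega> * x)\<close> and a damping factor; as \<open>k\<close> is nonnegative, the
  damped integral may be extended to (0,T), which frees it from x.\<close>

lemma E_le: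
  assumes "0 \<le> \<omega>" "x \<in> {0..T}"
  shows "E \<omega> x \<le> exp (\<omega> * x) * laplace_k \<omega>"
proof -
  have "E \<omega> x = (LINT t:{0<..<x}|lborel. exp (\<omega> * x) * (exp (- \<omega> * t) * k t))"
    unfolding I_R_def conv_def
    by (intro set_lebesgue_integral_cong) (auto simp: exp_minus exp_diff right_diff_distrib field_simps)
  also have "\<dots> = exp (\<omega> * x) * (LINT t:{0<..<x}|lborel. exp (- \<omega> * t) * k t)"
    by simp
  also have "\<dots> \<le> exp (\<omega> * x) * laplace_k \<omega>"
    unfolding laplace_k_def set_lebesgue_integral_def
    using assms damped_k_integrable[OF assms(1)] tail_kernelD(2)[OF k]
    by (intro mult_left_mono integral_mono) (auto simp: set_integrable_def indicator_def)
  finally show ?thesis .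
qed

lemma laplace_k_LIMSEQ: "(\<lambda>n. laplace_k (real n)) \<longlonglongrightarrow> 0"
proof -
  have "(\<lambda>n. \<integral>t. indicator {0<..<T} t *\<^sub>R (exp (- real n * t) * k t) \<partial>lborel) \<longlonglongrightarrow> (\<integral>t. 0 \<partial>(lborel :: real measure))"
  proof (rule integral_dominated_convergence)
    show "integrable lborel (\<lambda>t. indicator {0<..<T} t *\<^sub>R k t)"
      using tail_kernelD(4)[OF k] by (simp only: set_integrable_def)
    show "(\<lambda>t. indicator {0<..<T} t *\<^sub>R (exp (- real n * t) * k t)) \<in> borel_measurable lborel" for n
      using tail_kernelD(1)[OF k] by measurable
    show "AE t in lborel. norm (indicator {0<..<T} t *\<^sub>R (exp (- real n * t) * k t)) \<le> indicator {0<..<T} t *\<^sub>R k t" for n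
      using tail_kernelD(2)[OF k]
      by (intro AE_I2) (auto simp: abs_mult indicator_def intro!: mult_left_le_one_le)
    show "AE t in lborel. (\<lambda>n. indicator {0<..<T} t *\<^sub>R (exp (- real n * t) * k t)) \<longlonglongrightarrow> 0"
    proof (rule AE_I2)
      fix t :: real
      show "(\<lambda>n. indicator {0<..<T} t *\<^sub>R (exp (- real n * t) * k t)) \<longlonglongrightarrow> 0"
      proof (cases "t \<in> {0<..<T}")
        case True
        have "(\<lambda>n. exp (- t) ^ n * k t) \<longlonglongrightarrow> 0 * k t"
          using True by (intro tendsto_mult LIMSEQ_power_zero tendsto_const) auto
        then show ?thesis using True by (simp add: exp_of_nat_mult[symmetric])
      qed simp
    qed
  qed simp
  then show ?thesis by (simp add: laplace_k_def set_lebesgue_integral_def)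
qed

text \<open>
  In the weighted norm \<open>sup \<bar>g x\<bar> exp (- \<omega> x)\<close> the operator \<open>J\<close> has norm at most
  \<open>laplace_k \<omega> / (1 - \<gamma>)\<close>, which is small for large \<open>\<omega>\<close>.
\<close>

lemma J_contraction:
  obtains \<omega> c where "0 \<le> \<omega>" "0 \<le> c" "\<bar>l\<bar> * c \<le> 1 / 2"
    "\<And>g A x. g \<in> CT \<Longrightarrow> (\<And>y. y \<in> {0..T} \<Longrightarrow> \<bar>g y\<bar> \<le> A * exp (\<omega> * y)) \<Longrightarrow> x \<in> {0..T} \<Longrightarrow>
       \<bar>J g x\<bar> \<le> A * c * exp (\<omega> * x)"
proof -
  have "(\<lambda>n. \<bar>l\<bar> * (laplace_k (real n) / (1 - \<gamma>))) \<longlonglongrightarrow> \<bar>l\<bar> * (0 / (1 - \<gamma>))"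
    using \<gamma>_less_1 by (intro tendsto_intros laplace_k_LIMSEQ) auto
  \<comment> \<open>Any threshold below 1 would do; 1/2 becomes the ratio of the geometric majorant
    of the Neumann series.\<close>
  then have "\<forall>\<^sub>F n in sequentially. \<bar>l\<bar> * (laplace_k (real n) / (1 - \<gamma>)) < 1 / 2"
    by (rule order_tendstoD) simp
  then obtain n where n: "\<bar>l\<bar> * (laplace_k (real n) / (1 - \<gamma>)) < 1 / 2"
    by (auto simp: eventually_sequentially)
  have nonneg: "0 \<le> laplace_k (real n)"
    unfolding laplace_k_def set_lebesgue_integral_def
    using tail_kernelD(2)[OF k] by (intro Bochner_Integration.integral_nonneg) auto
  show thesis
  proof (rule that[of "real n" "laplace_k (real n) / (1 - \<gamma>)"])
    fix g A x
    assume g: "g \<in> CT" and le: "\<And>y. y \<in> {0..T} \<Longrightarrow> \<bar>g y\<bar> \<le> A * exp (real n * y)" and x: "x \<in> {0..T}"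
    have A: "0 \<le> A" using le[of 0] T_pos by (simp add: order_trans[OF abs_ge_zero])
    have "\<bar>J g x\<bar> \<le> A * (E (real n) x / (1 - \<gamma>))"
      by (rule J_le[OF g _ le x]) auto
    also have "\<dots> \<le> A * (exp (real n * x) * laplace_k (real n) / (1 - \<gamma>))"
      using A \<gamma>_less_1 E_le[OF _ x] by (intro mult_left_mono divide_right_mono) auto
    finally show "\<bar>J g x\<bar> \<le> A * (laplace_k (real n) / (1 - \<gamma>)) * exp (real n * x)"
      by (simp add: mult_ac)
  qed (use n nonneg \<gamma>_less_1 in auto)
qed

section \<open>The Neumann series of l times \<open>J\<close>\<close>

lemma J_funpow_CT: "g \<in> CT \<Longrightarrow> (J ^^ i) g \<in> CT"
  by (induction i) (auto simp: J_CT[simplified])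

text \<open>The resolvent: the inverse of the identity minus l times \<open>J\<close>, applied to
  g.\<close>

definition neumann :: "real \<Rightarrow> (real \<Rightarrow> real) \<Rightarrow> real \<Rightarrow> real" where
  "neumann l g x = (\<Sum>i. l ^ i * (J ^^ i) g x)"

lemma J_funpow_le:
  assumes g: "g \<in> CT"
  obtains B where "0 \<le> B" "\<And>i x. x \<in> {0..T} \<Longrightarrow> \<bar>l ^ i * (J ^^ i) g x\<bar> \<le> B * (1 / 2) ^ i"
proof -
  obtain \<omega> c where \<omega>: "0 \<le> \<omega>" and c: "0 \<le> c" "\<bar>l\<bar> * c \<le> 1 / 2"
    and J: "\<And>g A x. g \<in> CT \<Longrightarrow> (\<And>y. y \<in> {0..T} \<Longrightarrow> \<bar>g y\<bar> \<le> A * exp (\<omega> * y)) \<Longrightarrow> x \<in> {0..T} \<Longrightarrow>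
       \<bar>J g x\<bar> \<le> A * c * exp (\<omega> * x)"
    by (rule J_contraction[of l], erule that, assumption, assumption, blast)
  obtain A where A: "0 \<le> A" "\<And>x. x \<in> {0..T} \<Longrightarrow> \<bar>g x\<bar> \<le> A * exp (\<omega> * x)"
    by (rule exp_bound[OF g \<omega>]) (rule that)
  have le: "\<bar>(J ^^ i) g x\<bar> \<le> A * c ^ i * exp (\<omega> * x)" if "x \<in> {0..T}" for i x
    using that
  proof (induction i arbitrary: x)
    case (Suc i)
    from J[OF J_funpow_CT[OF g] Suc.IH Suc.prems] show ?case by (simp add: mult_ac)
  qed (simp add: A)
  \<comment> \<open>The factor \<open>exp (\<omega> * T)\<close> is the price for passing from the
    weighted to the unweighted sup norm.\<close>
  show thesis
  proof (rule that[of "A * exp (\<omega> * T)"])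
    fix i x assume x: "x \<in> {0..T}"
    have "\<bar>l ^ i * (J ^^ i) g x\<bar> = \<bar>l\<bar> ^ i * \<bar>(J ^^ i) g x\<bar>"
      by (simp add: abs_mult power_abs)
    also have "\<dots> \<le> \<bar>l\<bar> ^ i * (A * c ^ i * exp (\<omega> * x))"
      by (intro mult_left_mono le[OF x]) simp
    also have "\<dots> = A * ((\<bar>l\<bar> * c) ^ i * exp (\<omega> * x))"
      by (simp add: power_mult_distrib mult_ac)
    also have "\<dots> \<le> A * ((1 / 2) ^ i * exp (\<omega> * T))"
      using A(1) c x \<omega> by (intro mult_left_mono mult_mono power_mono) (auto simp: mult_left_mono)
    finally show "\<bar>l ^ i * (J ^^ i) g x\<bar> \<le> A * exp (\<omega> * T) * (1 / 2) ^ i"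
      by (simp add: mult_ac)
  qed (use A in auto)
qed

lemma neumann_summable:
  assumes "g \<in> CT" "x \<in> {0..T}"
  shows "summable (\<lambda>i. l ^ i * (J ^^ i) g x)"
proof -
  obtain B where B: "0 \<le> B" "\<And>i x. x \<in> {0..T} \<Longrightarrow> \<bar>l ^ i * (J ^^ i) g x\<bar> \<le> B * (1 / 2) ^ i"
    by (rule J_funpow_le[OF assms(1)]) (rule that)
  show ?thesis
    by (rule summable_comparison_test'[of "\<lambda>i. B * (1 / 2) ^ i" 0])
       (use B assms in \<open>auto intro!: summable_mult summable_geometric\<close>)
qed

lemma neumann_uniform_limit:
  assumes "g \<in> CT"
  shows "uniform_limit {0..T} (\<lambda>n x. \<Sum>i<n. l ^ i * (J ^^ i) g x) (neumann l g) sequentially"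
proof -
  obtain B where B: "0 \<le> B" "\<And>i x. x \<in> {0..T} \<Longrightarrow> \<bar>l ^ i * (J ^^ i) g x\<bar> \<le> B * (1 / 2) ^ i"
    by (rule J_funpow_le[OF assms]) (rule that)
  have "uniform_limit {0..T} (\<lambda>n x. \<Sum>i<n. l ^ i * (J ^^ i) g x) (\<lambda>x. \<Sum>i. l ^ i * (J ^^ i) g x) sequentially"
    by (rule Weierstrass_m_test[of _ _ "\<lambda>i. B * (1 / 2) ^ i"])
       (use B in \<open>auto intro!: summable_mult summable_geometric\<close>)
  then show ?thesis by (simp add: neumann_def[abs_def])
qed

lemma neumann_partial_CT: "g \<in> CT \<Longrightarrow> (\<lambda>x. \<Sum>i<n. l ^ i * (J ^^ i) g x) \<in> CT"
  using J_funpow_CT by (auto intro!: continuous_on_sum continuous_on_mult continuous_on_const)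

lemma neumann_CT: "g \<in> CT \<Longrightarrow> neumann l g \<in> CT"
  using uniform_limit_theorem[OF _ neumann_uniform_limit] neumann_partial_CT by auto

text \<open>\<open>J\<close> passes through the series because it is bounded in the unweighted sup
  norm, which is the case \<omega> = 0 of \<open>J_le\<close>.\<close>

lemma J_neumann:
  assumes g: "g \<in> CT" and x: "x \<in> {0..T}"
  shows "(\<lambda>i. l ^ i * (J ^^ (i + 1)) g x) sums J (neumann l g) x"
proof -
  let ?S = "\<lambda>n x. \<Sum>i<n. l ^ i * (J ^^ i) g x"
  have JS: "J (?S n) x = (\<Sum>i<n. l ^ i * (J ^^ (i + 1)) g x)" for n
  proof (induction n)
    case 0
    \<comment> \<open>The empty partial sum is written as a linear combination, so that linearity
      shows that \<open>J\<close> maps it to 0.\<close>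
    have "J (\<lambda>_. 0 * 1 + 0 * 1) x = 0 * J (\<lambda>_. 1) x + 0 * J (\<lambda>_. 1) x"
      by (rule J_linear) (use x in auto)
    then show ?case by simp
  next
    case (Suc n)
    have "J (\<lambda>x. 1 * ?S n x + l ^ n * (J ^^ n) g x) x = 1 * J (?S n) x + l ^ n * J ((J ^^ n) g) x"
      by (intro J_linear neumann_partial_CT J_funpow_CT g x)
    then show ?case using Suc by simp
  qed
  have "(\<lambda>n. J (?S n) x) \<longlonglongrightarrow> J (neumann l g) x"
  proof (rule tendsto_of_uniform_limit[OF neumann_uniform_limit[OF g]])
    show "0 \<le> E 0 x / (1 - \<gamma>)" using E_nonneg[of 0 x] \<gamma>_less_1 by (intro divide_nonneg_nonneg) auto
    fix n e assume e: "\<And>y. y \<in> {0..T} \<Longrightarrow> \<bar>?S n y - neumann l g y\<bar> \<le> e"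
    have "J (\<lambda>y. 1 * ?S n y + (-1) * neumann l g y) x = 1 * J (?S n) x + (-1) * J (neumann l g) x"
      by (intro J_linear neumann_partial_CT neumann_CT g x)
    moreover have "\<bar>J (\<lambda>y. 1 * ?S n y + (-1) * neumann l g y) x\<bar> \<le> e * (E 0 x / (1 - \<gamma>))"
      by (rule J_le[OF CT_lin[OF neumann_partial_CT[OF g] neumann_CT[OF g]] _ _ x]) (use e in auto)
    ultimately show "\<bar>J (?S n) x - J (neumann l g) x\<bar> \<le> E 0 x / (1 - \<gamma>) * e"
      by (simp add: mult.commute)
  qed
  then show ?thesis by (simp add: sums_def JS)
qed

lemma neumann_eq:
  assumes "g \<in> CT" "x \<in> {0..T}"
  shows "neumann l g x = g x + l * J (neumann l g) x"
proof -
  have "neumann l g x = (\<Sum>i. l ^ Suc i * (J ^^ Suc i) g x) + l ^ 0 * (J ^^ 0) g x"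
    unfolding neumann_def using suminf_split_head[OF neumann_summable[OF assms]] by simp
  also have "(\<Sum>i. l ^ Suc i * (J ^^ Suc i) g x) = l * J (neumann l g) x"
    using sums_unique[OF sums_mult[OF J_neumann[OF assms]]] by (simp add: mult_ac)
  finally show ?thesis by simp
qed

text \<open>Iterating the equation gives e = \<open>l ^ i * (J ^^ i) e\<close> on [0,T] for every i,
  and these terms are bounded by a constant times 2^(-i).\<close>

lemma J_eigenfunction_eq_0:
  assumes e: "e \<in> CT" and eq: "\<And>x. x \<in> {0..T} \<Longrightarrow> e x = l * J e x" and x: "x \<in> {0..T}"
  shows "e x = 0"
proof -
  obtain B where B: "0 \<le> B" "\<And>i x. x \<in> {0..T} \<Longrightarrow> \<bar>l ^ i * (J ^^ i) e x\<bar> \<le> B * (1 / 2) ^ i"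
    by (rule J_funpow_le[OF e]) (rule that)
  have "l ^ i * (J ^^ i) e x = e x" if "x \<in> {0..T}" for i x
    using that
  proof (induction i arbitrary: x)
    case (Suc i)
    have "J e x = J (\<lambda>y. l ^ i * (J ^^ i) e y + 0 * (J ^^ i) e y) x"
      using Suc by (intro J_cong) auto
    also have "\<dots> = l ^ i * J ((J ^^ i) e) x + 0 * J ((J ^^ i) e) x"
      by (intro J_linear J_funpow_CT e Suc.prems)
    finally show ?case using eq[OF Suc.prems] by simp
  qed simp
  then have "\<bar>e x\<bar> \<le> B * (1 / 2) ^ i" for i using B(2)[OF x] x by metis
  moreover have "(\<lambda>i. B * (1 / 2) ^ i) \<longlonglongrightarrow> B * 0"
    by (intro tendsto_mult LIMSEQ_power_zero tendsto_const) auto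
  ultimately have "\<bar>e x\<bar> \<le> B * 0"
    by (intro LIMSEQ_le_const[where X="\<lambda>i. B * (1 / 2) ^ i"]) auto
  then show ?thesis by simp
qed

theorem censored_ivp:
  fixes l \<phi>\<^sub>0 :: real
  assumes g: "g \<in> CT"
  defines "\<phi> \<equiv> \<lambda>x. \<phi>\<^sub>0 * (\<Sum>i. l ^ i * (J ^^ i) (\<lambda>_. 1) x) + (\<Sum>i. l ^ i * (J ^^ (i + 1)) g x)"
  shows "\<phi> \<in> C_Icc mb T" "solves_ivp mb T \<phi>\<^sub>0 l g \<phi>"
    "\<psi> \<in> C_Icc mb T \<Longrightarrow> solves_ivp mb T \<phi>\<^sub>0 l g \<psi> \<Longrightarrow> x \<in> {0..T} \<Longrightarrow> \<psi> x = \<phi> x"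
proof -
  let ?N1 = "neumann l (\<lambda>_. 1)" and ?Ng = "neumann l g"
  let ?\<phi> = "\<lambda>x. \<phi>\<^sub>0 * ?N1 x + 1 * J ?Ng x"
  have one: "(\<lambda>_. 1) \<in> CT" by auto
  note N = neumann_CT[OF one, of l] neumann_CT[OF g, of l] J_CT[OF neumann_CT[OF g, of l]]
  have \<phi>_eq: "\<phi> x = ?\<phi> x" if "x \<in> {0..T}" for x
    using sums_unique[OF J_neumann[OF g that, of l]] by (simp add: \<phi>_def neumann_def)
  have "?\<phi> \<in> CT" by (intro CT_lin N)
  then have CT: "\<phi> \<in> CT" using continuous_on_eq[of "{0..T}" ?\<phi> \<phi>] \<phi>_eq by simp
  have G: "(\<lambda>x. l * \<psi> x + g x) \<in> CT" if "\<psi> \<in> CT" for \<psi>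
    using that g by (auto intro!: continuous_intros)
  have int_eq: "\<phi> x = \<phi>\<^sub>0 + J (\<lambda>x. l * \<phi> x + g x) x" if x: "x \<in> {0..T}" for x
  proof -
    \<comment> \<open>The resolvent equation for g merges g and the term l times
      \<open>J ?Ng\<close> of the source into \<open>?Ng\<close>. The resolvent equation for 1 then
      evaluates l times \<open>J ?N1\<close> as \<open>?N1 - 1\<close>, which leaves \<phi> minus
      its initial value.\<close>
    have "J (\<lambda>x. l * \<phi> x + g x) x = J (\<lambda>x. (l * \<phi>\<^sub>0) * ?N1 x + 1 * ?Ng x) x"
      using x neumann_eq[OF g, of _ l] by (intro J_cong) (simp_all add: \<phi>_eq algebra_simps)
    also have "\<dots> = (l * \<phi>\<^sub>0) * J ?N1 x + 1 * J ?Ng x"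
      by (intro J_linear N x)
    finally show ?thesis
      using neumann_eq[OF one x, of l] by (simp add: \<phi>_eq[OF x] algebra_simps)
  qed
  have \<phi>_0: "\<phi> 0 = \<phi>\<^sub>0" using int_eq[of 0] T_pos by simp
  have fix_eq: "\<phi> x = K \<phi> x + R (\<lambda>x. l * \<phi> x + g x) x" if x: "0 < x" "x \<le> T" for x
  proof -
    have x': "x \<in> {0..T}" using x by auto
    let ?u = "J (\<lambda>x. l * \<phi> x + g x)"
    have u: "?u \<in> CT" by (intro J_CT G CT)
    have "K \<phi> x = K (\<lambda>x. \<phi>\<^sub>0 * 1 + 1 * ?u x) x"
      using x int_eq by (intro K_cong) auto
    also have "\<dots> = \<phi>\<^sub>0 * K (\<lambda>_. 1) x + 1 * K ?u x"
      by (intro K_linear one u x')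
    finally have "K \<phi> x = \<phi>\<^sub>0 + K ?u x" using x by (simp add: K_const)
    with int_eq[OF x'] J_eq[OF G[OF CT] x'] show ?thesis by simp
  qed
  show "\<phi> \<in> C_Icc mb T" by (rule censored_deriv_of_eq(1)[OF CT G[OF CT] fix_eq])
  show "solves_ivp mb T \<phi>\<^sub>0 l g \<phi>"
    using censored_deriv_of_eq(2)[OF CT G[OF CT] fix_eq] \<phi>_0 by (simp add: solves_ivp_def)
  show "\<psi> x = \<phi> x" if \<psi>: "\<psi> \<in> C_Icc mb T" "solves_ivp mb T \<phi>\<^sub>0 l g \<psi>" and x: "x \<in> {0..T}"
  proof -
    have C: "\<psi> \<in> CT" using \<psi>(1) by (simp add: C_Icc_def)
    have fix_\<psi>: "\<psi> y = K \<psi> y + R (\<lambda>x. l * \<psi> x + g x) y" if "0 < y" "y \<le> T" for y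
      by (rule eq_of_censored_deriv[OF \<psi>(1) G[OF C] _ that]) (use \<psi>(2) in \<open>auto simp: solves_ivp_def\<close>)
    have \<psi>_eq: "\<psi> y = \<phi>\<^sub>0 + J (\<lambda>x. l * \<psi> x + g x) y" if "y \<in> {0..T}" for y
      using J_unique[OF C G[OF C] fix_\<psi> that] \<psi>(2) unfolding solves_ivp_def by metis
    let ?e = "\<lambda>x. 1 * \<psi> x + (-1) * \<phi> x"
    have e: "?e \<in> CT" by (intro CT_lin C CT)
    have "?e x = 0"
    \<comment> \<open>The inhomogeneity and the initial value cancel in the difference of the two
      integral equations.\<close>
    proof (rule J_eigenfunction_eq_0[OF e _ x, of l])
      fix y assume y: "y \<in> {0..T}"
      have "J (\<lambda>x. 1 * (l * \<psi> x + g x) + (-1) * (l * \<phi> x + g x)) y =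
          1 * J (\<lambda>x. l * \<psi> x + g x) y + (-1) * J (\<lambda>x. l * \<phi> x + g x) y"
        by (rule J_linear[OF G[OF C] G[OF CT] y])
      moreover have "J (\<lambda>x. 1 * (l * \<psi> x + g x) + (-1) * (l * \<phi> x + g x)) y = J (\<lambda>x. l * ?e x + 0 * ?e x) y"
        using y by (intro J_cong) (auto simp: algebra_simps)
      moreover have "J (\<lambda>x. l * ?e x + 0 * ?e x) y = l * J ?e y + 0 * J ?e y"
        by (intro J_linear e y)
      ultimately show "?e y = l * J ?e y"
        using \<psi>_eq[OF y] int_eq[OF y] by linarith
    qed
    then show ?thesis by simp
  qed
qed

end

section \<open>Laplace transforms of Levy tails\<close>

text \<open>Finiteness of the tails is Markov's inequality for min(1,t). For x < 0 the ray is not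
  contained in the space, so it is not measurable and \<open>measure\<close> assigns it 0;
  measurability of the tail on the whole line relies on this value.\<close>

lemma levy_measureD:
  assumes "levy_measure mu"
  shows "space mu = {0<..}" "(\<lambda>t. t) \<in> borel_measurable mu" "0 \<le> x \<Longrightarrow> {x<..} \<in> sets mu"
    "x < 0 \<Longrightarrow> {x<..} \<notin> sets mu" "0 < x \<Longrightarrow> emeasure mu {x<..} < \<infinity>"
proof -
  have sets: "sets mu = sets (restrict_space borel {0<..})"
    and fin: "(\<integral>\<^sup>+ t. ennreal (min 1 t) \<partial>mu) < \<infinity>"
    using assms by (auto simp: levy_measure_def)
  show sp: "space mu = {0<..}"
    using sets_eq_imp_space_eq[OF sets] by (simp add: space_restrict_space)
  show id: "(\<lambda>t. t) \<in> borel_measurable mu"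
    by (subst measurable_cong_sets[OF sets refl]) (rule measurable_restrict_space1, simp)
  show S: "{x<..} \<in> sets mu" if "0 \<le> x" for x
  proof -
    have "{x<..} = {0<..} \<inter> {x<..}" using that by auto
    then have "{x<..} \<in> (\<inter>) {0<..} ` sets borel" by (rule image_eqI) simp
    then show ?thesis by (simp add: sets sets_restrict_space)
  qed
  show "{x<..} \<notin> sets mu" if "x < 0"
    using that sets.sets_into_space[of "{x<..}" mu] unfolding sp by force
  show "emeasure mu {x<..} < \<infinity>" if x: "0 < x"
  proof -
    have "ennreal (min 1 x) * emeasure mu {x<..} = (\<integral>\<^sup>+ t. ennreal (min 1 x) * indicator {x<..} t \<partial>mu)"
      using x S by (simp add: nn_integral_cmult_indicator)
    also have "\<dots> \<le> (\<integral>\<^sup>+ t. ennreal (min 1 t) \<partial>mu)"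
      by (intro nn_integral_mono) (auto simp: indicator_def intro: ennreal_leI)
    finally have "ennreal (min 1 x) * emeasure mu {x<..} < \<infinity>" using fin by simp
    then show ?thesis using x by (auto simp: ennreal_mult_less_top top.not_eq_extremum)
  qed
qed

lemma levy_measure_sigma_finite:
  assumes "levy_measure mu"
  shows "sigma_finite_measure mu"
proof
  let ?A = "range (\<lambda>n::nat. {1 / real (Suc n)<..})"
  have "\<Union>?A = space mu"
  proof
    show "space mu \<subseteq> \<Union>?A"
    proof
      fix x assume "x \<in> space mu"
      then have "0 < x" using levy_measureD(1)[OF assms] by simp
      then obtain n where "1 / real (Suc n) < x"
        using reals_Archimedean[of x] by (auto simp: inverse_eq_divide)
      then show "x \<in> \<Union>?A" by auto
    qed
  qed (auto simp: levy_measureD(1)[OF assms] intro: less_trans[rotated])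
  then show "\<exists>A. countable A \<and> A \<subseteq> sets mu \<and> \<Union>A = space mu \<and> (\<forall>a\<in>A. emeasure mu a \<noteq> \<infinity>)"
    using levy_measureD(3,5)[OF assms] by (intro exI[of _ ?A]) (auto simp: less_top)
qed

text \<open>Prepares Tonelli: with 1 - exp(-lt) in this form the Bernstein integral becomes a double
  integral over 0 < x < t.\<close>

lemma nn_integral_exp_Ioo:
  fixes l t :: real
  assumes "0 < l" "0 \<le> t"
  shows "(\<integral>\<^sup>+ x. ennreal (l * exp (- l * x)) * indicator {0<..<t} x \<partial>lborel) = ennreal (1 - exp (- l * t))"
proof -
  have "(\<integral>\<^sup>+ x. ennreal (l * exp (- l * x)) * indicator {0<..<t} x \<partial>lborel) =
        (\<integral>\<^sup>+ x. ennreal (l * exp (- l * x)) * indicator {0..t} x \<partial>lborel)"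
  proof (rule nn_integral_cong_AE)
    show "AE x in lborel. ennreal (l * exp (- l * x)) * indicator {0<..<t} x =
        ennreal (l * exp (- l * x)) * indicator {0..t} x"
      using AE_lborel_singleton[of 0] AE_lborel_singleton[of t]
      by eventually_elim (auto simp: indicator_def)
  qed
  also have "\<dots> = - exp (- l * t) - (- exp (- l * 0))"
    using assms by (intro nn_integral_FTC_Icc) (auto intro!: derivative_eq_intros)
  finally show ?thesis by simp
qed

lemma nn_integral_exp_Ioi:
  fixes l :: real
  assumes "0 < l"
  shows "(\<integral>\<^sup>+ x. ennreal (exp (- l * x)) * indicator {0<..} x \<partial>lborel) = ennreal (1 / l)"
proof -
  have "(\<integral>\<^sup>+ x. ennreal (exp (- l * x)) * indicator {0<..} x \<partial>lborel) =
        (\<integral>\<^sup>+ x. ennreal (exp (- l * x)) * indicator {0..} x \<partial>lborel)"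
    using AE_lborel_singleton[of "0::real"]
    by (intro nn_integral_cong_AE, eventually_elim) (auto simp: indicator_def)
  also have "\<dots> = 0 - (- exp (- l * 0) / l)"
  proof (rule nn_integral_FTC_atLeast)
    have "((\<lambda>x. exp (- (l * x))) \<longlongrightarrow> 0) at_top"
      using assms by (intro filterlim_compose[OF exp_at_bot] filterlim_compose[OF filterlim_uminus_at_bot_at_top]
          filterlim_tendsto_pos_mult_at_top[OF tendsto_const]) (auto simp: filterlim_ident)
    from tendsto_divide[OF tendsto_minus[OF this] tendsto_const[of l]] assms
    show "((\<lambda>x. - exp (- l * x) / l) \<longlongrightarrow> 0) at_top" by simp
  qed (use assms in \<open>auto intro!: derivative_eq_intros\<close>)
  finally show ?thesis by simp
qed

lemma levy_tail_eq_nn_integral: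
  assumes "levy_measure mu" "0 < x"
  shows "ennreal (levy_tail mu x) = (\<integral>\<^sup>+ t. indicator {x<..} t \<partial>mu)"
  using levy_measureD(3,5)[OF assms(1), of x] assms(2)
  by (simp add: levy_tail_def emeasure_eq_ennreal_measure)

lemma levy_tail_measurable:
  assumes "levy_measure mu"
  shows "levy_tail mu \<in> borel_measurable borel"
proof -
  interpret sigma_finite_measure mu by (rule levy_measure_sigma_finite[OF assms])
  note [measurable] = levy_measureD(2)[OF assms]
  have [measurable]: "(\<lambda>(x, t). if x < t then 1 else 0 :: ennreal) \<in> borel_measurable (borel \<Otimes>\<^sub>M mu)"
    by measurable
  have "(\<lambda>x. \<integral>\<^sup>+ t. (if x < t then 1 else 0) \<partial>mu) \<in> borel_measurable borel"
    by measurable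
  \<comment> \<open>At x = 0 the ray may have infinite mass; \<open>enn2real\<close> sends it to 0,
    as \<open>measure\<close> does.\<close>
  then have "(\<lambda>x. if x < 0 then 0 else enn2real (\<integral>\<^sup>+ t. (if x < t then 1 else 0) \<partial>mu)) \<in> borel_measurable borel"
    by measurable
  moreover have "levy_tail mu x = (if x < 0 then 0 else enn2real (\<integral>\<^sup>+ t. (if x < t then 1 else 0) \<partial>mu))" for x
  proof (cases "x < 0")
    case False
    have "(\<integral>\<^sup>+ t. (if x < t then 1 else 0) \<partial>mu) = (\<integral>\<^sup>+ t. indicator {x<..} t \<partial>mu)"
      by (intro nn_integral_cong) (auto simp: indicator_def)
    then show ?thesis
      using False levy_measureD(3)[OF assms, of x] by (simp add: levy_tail_def measure_def)
  qed (use levy_measureD(4)[OF assms, of x] in \<open>simp add: levy_tail_def measure_notin_sets\<close>)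
  ultimately show ?thesis by presburger
qed

text \<open>Valued in \<open>ennreal\<close>, so that Tonelli applies and products of transforms
  make sense before finiteness is known.\<close>

definition nn_laplace :: "(real \<Rightarrow> real) \<Rightarrow> real \<Rightarrow> ennreal" where
  "nn_laplace p l = (\<integral>\<^sup>+ x. ennreal (exp (- l * x) * p x) * indicator {0<..} x \<partial>lborel)"

lemma nn_laplace_measurable:
  assumes [measurable]: "p \<in> borel_measurable borel"
  shows "(\<lambda>x. ennreal (exp (- l * x) * p x) * indicator {0<..} x) \<in> borel_measurable lborel"
  by measurable

text \<open>Tonelli over 0 < x < t: integrating l exp(-lx) first in x gives 1 - exp(-lt), first in t
  it gives the tail at x.\<close>

lemma nn_laplace_levy_tail:
  assumes mu: "levy_measure mu" and l: "0 < l"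
  shows "(\<integral>\<^sup>+ t. ennreal (1 - exp (- l * t)) \<partial>mu) = ennreal l * nn_laplace (levy_tail mu) l"
proof -
  interpret mu: sigma_finite_measure mu by (rule levy_measure_sigma_finite[OF mu])
  interpret pair_sigma_finite lborel mu ..
  note [measurable] = levy_measureD(2)[OF mu] levy_tail_measurable[OF mu]
  let ?f = "\<lambda>x t. if 0 < x \<and> x < t then ennreal (l * exp (- l * x)) else 0"
  have "(\<integral>\<^sup>+ t. ennreal (1 - exp (- l * t)) \<partial>mu) = (\<integral>\<^sup>+ t. (\<integral>\<^sup>+ x. ?f x t \<partial>lborel) \<partial>mu)"
  proof (rule nn_integral_cong)
    fix t assume "t \<in> space mu"
    then have "0 \<le> t" using levy_measureD(1)[OF mu] by simp
    have "(\<integral>\<^sup>+ x. ?f x t \<partial>lborel) =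
        (\<integral>\<^sup>+ x. ennreal (l * exp (- l * x)) * indicator {0<..<t} x \<partial>lborel)"
      by (intro nn_integral_cong) (auto simp: indicator_def)
    then show "ennreal (1 - exp (- l * t)) = (\<integral>\<^sup>+ x. ?f x t \<partial>lborel)"
      using nn_integral_exp_Ioo[OF l \<open>0 \<le> t\<close>] by simp
  qed
  also have "\<dots> = (\<integral>\<^sup>+ x. (\<integral>\<^sup>+ t. ?f x t \<partial>mu) \<partial>lborel)"
    by (rule Fubini') measurable
  also have "\<dots> = (\<integral>\<^sup>+ x. ennreal l * (ennreal (exp (- l * x) * levy_tail mu x) * indicator {0<..} x) \<partial>lborel)"
  proof (rule nn_integral_cong)
    fix x :: real
    show "(\<integral>\<^sup>+ t. ?f x t \<partial>mu) = ennreal l * (ennreal (exp (- l * x) * levy_tail mu x) * indicator {0<..} x)"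
    proof (cases "0 < x")
      case True
      have "(\<integral>\<^sup>+ t. ?f x t \<partial>mu) = (\<integral>\<^sup>+ t. ennreal (l * exp (- l * x)) * indicator {x<..} t \<partial>mu)"
        using True by (intro nn_integral_cong) (auto simp: indicator_def)
      also have "\<dots> = ennreal (l * exp (- l * x)) * ennreal (levy_tail mu x)"
        using True levy_measureD(3)[OF mu, of x] by (subst levy_tail_eq_nn_integral[OF mu]) (auto simp: nn_integral_cmult)
      finally show ?thesis
        using True l by (simp add: ennreal_mult[symmetric] levy_tail_def mult_ac)
    qed simp
  qed
  also have "\<dots> = ennreal l * nn_laplace (levy_tail mu) l"
    unfolding nn_laplace_def
    by (rule nn_integral_cmult) (rule nn_laplace_measurable[OF levy_tail_measurable[OF mu]])
  finally show ?thesis .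
qed

text \<open>As 1 - exp(-lt) is at most max(1,l) min(1,t), the integrand in
  \<open>bernstein_triplet\<close> is integrable, and its Bochner integral agrees with the
  nonnegative one.\<close>

lemma bernstein_triplet_integral:
  assumes f: "bernstein_triplet f a b mu" and l: "0 < l"
  shows "0 \<le> (\<integral>t. (1 - exp (- l * t)) \<partial>mu)"
    "nn_laplace (levy_tail mu) l = ennreal ((\<integral>t. (1 - exp (- l * t)) \<partial>mu) / l)"
proof -
  have mu: "levy_measure mu" using f by (simp add: bernstein_triplet_def)
  note [measurable] = levy_measureD(2)[OF mu]
  have nonneg: "AE t in mu. 0 \<le> 1 - exp (- l * t)"
    using l levy_measureD(1)[OF mu] by (intro AE_I2) auto
  show nn: "0 \<le> (\<integral>t. (1 - exp (- l * t)) \<partial>mu)"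
    using nonneg by (rule integral_nonneg_AE)
  have "(\<integral>\<^sup>+ t. ennreal (1 - exp (- l * t)) \<partial>mu) \<le> (\<integral>\<^sup>+ t. ennreal (max 1 l) * ennreal (min 1 t) \<partial>mu)"
  proof (rule nn_integral_mono)
    fix t assume "t \<in> space mu"
    then have t: "0 < t" using levy_measureD(1)[OF mu] by simp
    have "1 - exp (- l * t) \<le> max 1 l * min 1 t"
    proof (cases "t \<le> 1")
      case True
      have "1 - exp (- l * t) \<le> l * t" using exp_ge_add_one_self[of "- l * t"] by simp
      also have "\<dots> \<le> max 1 l * t" using t by (intro mult_right_mono) auto
      finally show ?thesis using True by simp
    next
      case False
      have "1 - exp (- l * t) \<le> max 1 l" by (rule order_trans[of _ 1]) auto
      then show ?thesis using False by simp
    qed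
    then show "ennreal (1 - exp (- l * t)) \<le> ennreal (max 1 l) * ennreal (min 1 t)"
      using t by (subst ennreal_mult[symmetric]) (auto intro: ennreal_leI)
  qed
  also have "\<dots> = ennreal (max 1 l) * (\<integral>\<^sup>+ t. ennreal (min 1 t) \<partial>mu)"
    by (rule nn_integral_cmult) measurable
  also have "\<dots> < \<infinity>"
    using mu by (simp add: levy_measure_def ennreal_mult_less_top)
  finally have fin: "(\<integral>\<^sup>+ t. ennreal (1 - exp (- l * t)) \<partial>mu) < \<infinity>" .
  have "integrable mu (\<lambda>t. 1 - exp (- l * t))"
    using fin nonneg by (intro integrableI_nonneg) auto
  then have "ennreal (\<integral>t. (1 - exp (- l * t)) \<partial>mu) = ennreal l * nn_laplace (levy_tail mu) l"
    using nn_integral_eq_integral[OF _ nonneg] nn_laplace_levy_tail[OF mu l] by simp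
  then have "ennreal (1 / l) * ennreal (\<integral>t. (1 - exp (- l * t)) \<partial>mu) = (ennreal (1 / l) * ennreal l) * nn_laplace (levy_tail mu) l"
    by (simp add: mult.assoc)
  also have "ennreal (1 / l) * ennreal l = 1"
    using l by (simp add: ennreal_mult[symmetric])
  finally show "nn_laplace (levy_tail mu) l = ennreal ((\<integral>t. (1 - exp (- l * t)) \<partial>mu) / l)"
    using nn l by (simp add: ennreal_mult[symmetric])
qed

text \<open>Local integrability comes from the finite Laplace transform at 1: on (0,x) the factor
  exp(x - t) is at least 1.\<close>

lemma tail_kernel_levy_tail:
  assumes f: "bernstein_triplet f a b mu"
  shows "tail_kernel (levy_tail mu)"
proof -
  have mu: "levy_measure mu" using f by (simp add: bernstein_triplet_def)
  note [measurable] = levy_tail_measurable[OF mu]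
  have nonneg: "0 \<le> levy_tail mu x" for x by (simp add: levy_tail_def)
  have "antimono_on {0<..} (levy_tail mu)"
  proof (intro monotone_onI)
    fix x y :: real assume xy: "x \<in> {0<..}" "y \<in> {0<..}" "x \<le> y"
    show "levy_tail mu y \<le> levy_tail mu x"
      unfolding levy_tail_def
    proof (rule measure_mono_fmeasurable)
      show "{x<..} \<in> fmeasurable mu" using levy_measureD(3,5)[OF mu, of x] xy by (simp add: fmeasurable_def)
    qed (use xy levy_measureD(3)[OF mu, of y] in auto)
  qed
  moreover have "set_integrable lborel {0<..<x} (levy_tail mu)" if "0 < x" for x
    unfolding set_integrable_def
  proof (rule integrableI_nonneg)
    have "(\<integral>\<^sup>+ t. ennreal (indicator {0<..<x} t *\<^sub>R levy_tail mu t) \<partial>lborel) \<le>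
          (\<integral>\<^sup>+ t. ennreal (exp x) * (ennreal (exp (- 1 * t) * levy_tail mu t) * indicator {0<..} t) \<partial>lborel)"
    proof (rule nn_integral_mono)
      fix t :: real
      have "1 * levy_tail mu t \<le> exp (x - t) * levy_tail mu t" if "t < x"
        using that nonneg by (intro mult_right_mono) auto
      then have "levy_tail mu t \<le> exp x * (exp (- 1 * t) * levy_tail mu t)" if "t < x"
        using that by (simp add: exp_diff exp_minus field_simps)
      then show "ennreal (indicator {0<..<x} t *\<^sub>R levy_tail mu t) \<le>
          ennreal (exp x) * (ennreal (exp (- 1 * t) * levy_tail mu t) * indicator {0<..} t)"
        using nonneg by (auto simp: indicator_def ennreal_mult[symmetric] intro!: ennreal_leI)
    qed
    also have "\<dots> = ennreal (exp x) * nn_laplace (levy_tail mu) 1"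
      unfolding nn_laplace_def
    by (rule nn_integral_cmult) (rule nn_laplace_measurable[OF levy_tail_measurable[OF mu]])
    also have "\<dots> < \<infinity>"
      using bernstein_triplet_integral(2)[OF f, of 1] by (simp add: ennreal_mult_less_top)
    finally show "(\<integral>\<^sup>+ t. ennreal (indicator {0<..<x} t *\<^sub>R levy_tail mu t) \<partial>lborel) < \<infinity>" .
  qed (auto simp: nonneg)
  ultimately show ?thesis using nonneg by (auto simp: tail_kernel_def)
qed

text \<open>Damping both factors and cutting them off at 0 turns the convolution into one over the
  whole line, where Tonelli and translation invariance split the double integral.\<close>

lemma nn_laplace_conv:
  assumes p: "tail_kernel p" and q: "tail_kernel q"
  shows "nn_laplace (conv p q) l = nn_laplace p l * nn_laplace q l"
proof -
  have [measurable]: "p \<in> borel_measurable borel" "q \<in> borel_measurable borel"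
    using p q by (auto dest: tail_kernelD)
  have nonneg: "0 \<le> p x" "0 \<le> q x" for x using tail_kernelD(2) p q by auto
  define P where "P x = ennreal (exp (- l * x) * p x) * indicator {0<..} x" for x
  define Q where "Q x = ennreal (exp (- l * x) * q x) * indicator {0<..} x" for x
  have [measurable]: "P \<in> borel_measurable borel" "Q \<in> borel_measurable borel"
    unfolding P_def Q_def by measurable
  have eq: "ennreal (exp (- l * x) * conv p q x) * indicator {0<..} x = (\<integral>\<^sup>+ t. P (x - t) * Q t \<partial>lborel)" for x
  proof -
    have "ennreal (conv p q x) = (\<integral>\<^sup>+ t. ennreal (indicator {0<..<x} t *\<^sub>R (p (x - t) * q t)) \<partial>lborel)"
      unfolding conv_def set_lebesgue_integral_def
      using tail_kernel_mult_integrable[OF p q, of x] nonneg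
      by (intro nn_integral_eq_integral[symmetric]) (auto simp: set_integrable_def)
    moreover have "0 \<le> conv p q x"
      unfolding conv_def set_lebesgue_integral_def
      using nonneg by (intro Bochner_Integration.integral_nonneg) auto
    ultimately have "ennreal (exp (- l * x) * conv p q x) =
        (\<integral>\<^sup>+ t. ennreal (exp (- l * x)) * ennreal (indicator {0<..<x} t *\<^sub>R (p (x - t) * q t)) \<partial>lborel)"
      by (subst nn_integral_cmult) (auto simp: ennreal_mult)
    also have "\<dots> = (\<integral>\<^sup>+ t. P (x - t) * Q t \<partial>lborel)"
    proof (rule nn_integral_cong)
      fix t :: real
      have "exp (- (l * x)) = exp (- (l * (x - t))) * exp (- (l * t))"
        by (simp add: exp_add[symmetric] algebra_simps)
      then show "ennreal (exp (- l * x)) * ennreal (indicator {0<..<x} t *\<^sub>R (p (x - t) * q t)) = P (x - t) * Q t"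
        using nonneg by (auto simp: P_def Q_def indicator_def ennreal_mult[symmetric] mult_ac)
    qed
    finally show ?thesis
    proof (cases "0 < x")
      case False
      have "(\<integral>\<^sup>+ t. P (x - t) * Q t \<partial>lborel) = (\<integral>\<^sup>+ t. 0 \<partial>(lborel :: real measure))"
        using False by (intro nn_integral_cong) (auto simp: P_def Q_def indicator_def)
      then show ?thesis using False by simp
    qed simp
  qed
  have "nn_laplace (conv p q) l = (\<integral>\<^sup>+ x. (\<integral>\<^sup>+ t. P (x - t) * Q t \<partial>lborel) \<partial>lborel)"
    unfolding nn_laplace_def eq ..
  also have "\<dots> = (\<integral>\<^sup>+ t. (\<integral>\<^sup>+ x. P (x - t) * Q t \<partial>lborel) \<partial>lborel)"
    by (rule lborel_pair.Fubini') measurable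
  also have "\<dots> = (\<integral>\<^sup>+ t. (\<integral>\<^sup>+ x. P x \<partial>lborel) * Q t \<partial>lborel)"
  proof (rule nn_integral_cong)
    fix t :: real
    have "(\<integral>\<^sup>+ x. P (x - t) * Q t \<partial>lborel) = (\<integral>\<^sup>+ x. P (x - t) \<partial>lborel) * Q t"
      by (rule nn_integral_multc) measurable
    also have "(\<integral>\<^sup>+ x. P (x - t) \<partial>lborel) = (\<integral>\<^sup>+ x. P x \<partial>lborel)"
      using nn_integral_real_affine[of "\<lambda>x. P (x - t)" 1 t] by simp
    finally show "(\<integral>\<^sup>+ x. P (x - t) * Q t \<partial>lborel) = (\<integral>\<^sup>+ x. P x \<partial>lborel) * Q t" .
  qed
  also have "\<dots> = (\<integral>\<^sup>+ x. P x \<partial>lborel) * (\<integral>\<^sup>+ t. Q t \<partial>lborel)"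
    by (rule nn_integral_cmult) measurable
  finally show ?thesis by (simp add: nn_laplace_def P_def Q_def)
qed

text \<open>
  Under \<open>y = exp (- x)\<close> the hypothesis says that all monomials integrate to \<open>0\<close> against \<open>H\<close>;
  by Weierstrass approximation so does every continuous function of \<open>y\<close>.
\<close>

lemma integral_compose_exp_eq_0:
  fixes H :: "real \<Rightarrow> real"
  assumes H: "set_integrable lborel {0<..} H"
    and zero: "\<And>n::nat. (LINT x:{0<..}|lborel. exp (- real n * x) * H x) = 0"
    and \<phi>: "continuous_on {0..1} \<phi>" and \<phi>_meas: "\<phi> \<in> borel_measurable borel"
  shows "(LINT x:{0<..}|lborel. \<phi> (exp (- x)) * H x) = 0"
proof -
  have int: "set_integrable lborel {0<..} (\<lambda>x. \<psi> (exp (- x)) * H x)"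
    if \<psi>: "continuous_on {0..1} \<psi>" "\<psi> \<in> borel_measurable borel" for \<psi> :: "real \<Rightarrow> real"
  proof -
    note [measurable] = \<psi>(2)
    obtain M where M: "0 \<le> M" "\<And>x. x \<in> {0..1} \<Longrightarrow> \<bar>\<psi> x\<bar> \<le> M"
      by (rule continuous_on_Icc_bounded[OF \<psi>(1)]) (rule that)
    show ?thesis
    proof (rule set_integrable_bound)
      show "set_integrable lborel {0<..} (\<lambda>x. M * H x)" using H by simp
      have "(\<lambda>x. \<psi> (exp (- x)) * (indicator {0<..} x *\<^sub>R H x)) \<in> borel_measurable lborel"
        using H unfolding set_integrable_def by (intro borel_measurable_times) auto
      then show "set_borel_measurable lborel {0<..} (\<lambda>x. \<psi> (exp (- x)) * H x)"
        by (simp add: set_borel_measurable_def mult_ac)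
      show "AE x in lborel. x \<in> {0<..} \<longrightarrow> norm (\<psi> (exp (- x)) * H x) \<le> norm (M * H x)"
        using M by (intro AE_I2) (auto simp: abs_mult intro!: mult_right_mono)
    qed
  qed
  have poly: "(LINT x:{0<..}|lborel. p (exp (- x)) * H x) = 0" if p: "real_polynomial_function p" for p
  proof -
    obtain a n where p_eq: "p = (\<lambda>x. \<Sum>i\<le>n. a i * x ^ i)"
      using p unfolding real_polynomial_function_iff_sum by blast
    have i: "set_integrable lborel {0<..} (\<lambda>x. exp (- real i * x) * H x)" for i :: nat
      using int[of "\<lambda>y. y ^ i"] by (simp add: continuous_intros exp_of_nat_mult[symmetric])
    have "(LINT x:{0<..}|lborel. p (exp (- x)) * H x) =
        (\<integral>x. (\<Sum>i\<le>n. a i * (indicator {0<..} x *\<^sub>R (exp (- real i * x) * H x))) \<partial>lborel)"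
      unfolding set_lebesgue_integral_def p_eq
      by (intro Bochner_Integration.integral_cong)
         (auto simp: sum_distrib_right sum_distrib_left exp_of_nat_mult[symmetric] mult_ac)
    also have "\<dots> = (\<Sum>i\<le>n. a i * (LINT x:{0<..}|lborel. exp (- real i * x) * H x))"
      using i by (simp add: set_integrable_def set_lebesgue_integral_def)
    finally show ?thesis unfolding zero by simp
  qed
  define C where "C = (LINT x:{0<..}|lborel. \<bar>H x\<bar>)"
  have C: "0 \<le> C" unfolding C_def set_lebesgue_integral_def
    by (intro Bochner_Integration.integral_nonneg) auto
  have "\<bar>LINT x:{0<..}|lborel. \<phi> (exp (- x)) * H x\<bar> \<le> 0 + e" if e: "0 < e" for e
  proof -
    have "0 < e / (C + 1)" using e C by simp
    from Stone_Weierstrass_polynomial_function[OF compact_Icc \<phi> this]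
    obtain p where p: "polynomial_function p" "\<And>x. x \<in> {0..1} \<Longrightarrow> norm (\<phi> x - p x) < e / (C + 1)"
      by auto
    have rp: "real_polynomial_function p" using p(1) by (simp add: real_polynomial_function_eq)
    have pc: "continuous_on {0..1} p" "p \<in> borel_measurable borel"
      using continuous_on_polymonial_function[OF p(1)] by (auto intro: borel_measurable_continuous_onI)
    have "(LINT x:{0<..}|lborel. \<phi> (exp (- x)) * H x) =
        (LINT x:{0<..}|lborel. \<phi> (exp (- x)) * H x) - (LINT x:{0<..}|lborel. p (exp (- x)) * H x)"
      using poly[OF rp] by simp
    also have "\<dots> = (LINT x:{0<..}|lborel. \<phi> (exp (- x)) * H x - p (exp (- x)) * H x)"
      using int[OF \<phi> \<phi>_meas] int[OF pc] by simp
    also have "\<bar>\<dots>\<bar> \<le> (LINT x:{0<..}|lborel. e / (C + 1) * \<bar>H x\<bar>)"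
    proof (rule abs_LINT_le)
      show "set_integrable lborel {0<..} (\<lambda>x. \<phi> (exp (- x)) * H x - p (exp (- x)) * H x)"
        using int[OF \<phi> \<phi>_meas] int[OF pc] by simp
      show "set_integrable lborel {0<..} (\<lambda>x. e / (C + 1) * \<bar>H x\<bar>)"
        using set_integrable_abs[OF H] by (rule set_integrable_mult_right)
      show "\<bar>\<phi> (exp (- x)) * H x - p (exp (- x)) * H x\<bar> \<le> e / (C + 1) * \<bar>H x\<bar>" if "x \<in> {0<..}" for x
        using p(2)[of "exp (- x)"] that
        by (simp only: left_diff_distrib[symmetric] abs_mult) (intro mult_right_mono; simp)
    qed
    also have "\<dots> = e / (C + 1) * C" by (simp add: C_def)
    also have "\<dots> \<le> e" using C e by (simp add: field_simps)
    finally show ?thesis by simp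
  qed
  then have "\<bar>LINT x:{0<..}|lborel. \<phi> (exp (- x)) * H x\<bar> \<le> 0"
    by (rule field_le_epsilon)
  then show ?thesis by simp
qed

text \<open>If \<open>H\<close> were positive at z, a bump in exp(-x) supported near z would have a
  positive integral against \<open>H\<close>, while \<open>integral_compose_exp_eq_0\<close> makes
  it 0. The one-sided form can be applied to \<open>H\<close> and to its negative.\<close>

lemma laplace_eq_0_nonpos:
  fixes H :: "real \<Rightarrow> real"
  assumes H: "set_integrable lborel {0<..} H" and cont: "continuous_on {0<..} H"
    and zero: "\<And>n::nat. (LINT x:{0<..}|lborel. exp (- real n * x) * H x) = 0"
    and z: "0 < z"
  shows "H z \<le> 0"
proof (rule ccontr)
  assume "\<not> H z \<le> 0"
  then have Hz: "0 < H z" by simp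
  have "isCont H z" using cont z by (simp add: continuous_on_eq_continuous_at)
  then obtain d0 where d0: "0 < d0" "\<And>x. \<bar>x - z\<bar> < d0 \<Longrightarrow> \<bar>H x - H z\<bar> < H z"
    using Hz unfolding continuous_at_real_range by (auto simp: dist_real_def)
  \<comment> \<open>The bound by z keeps the window around z inside the positive half-line.\<close>
  define d where "d = min d0 z"
  have d: "0 < d" "d \<le> z" "\<And>x. \<bar>x - z\<bar> < d \<Longrightarrow> 0 < H x"
    using d0 z by (auto simp: d_def) (smt (verit))
  define \<alpha> where "\<alpha> = exp (- (z + d))"
  define \<beta> where "\<beta> = exp (- (z - d))"
  \<comment> \<open>The quadratic is positive exactly for y between \<alpha> and \<beta>, which for
    \<open>y = exp (- x)\<close> means \<open>\<bar>x - z\<bar> < d\<close>.\<close>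
  define \<phi> where "\<phi> y = max 0 ((y - \<alpha>) * (\<beta> - y))" for y
  have \<phi>_pos: "0 < \<phi> (exp (- x))" if "\<bar>x - z\<bar> < d" for x
  proof -
    have "0 < (exp (- x) - \<alpha>) * (\<beta> - exp (- x))"
      using that unfolding \<alpha>_def \<beta>_def by (intro mult_pos_pos) auto
    then show ?thesis by (simp add: \<phi>_def)
  qed
  have \<phi>_0: "\<phi> (exp (- x)) = 0" if "\<not> \<bar>x - z\<bar> < d" for x
  proof -
    have "exp (- x) \<le> \<alpha> \<or> \<beta> \<le> exp (- x)" using that unfolding \<alpha>_def \<beta>_def by auto
    moreover have "\<alpha> \<le> \<beta>" using d(1) by (simp add: \<alpha>_def \<beta>_def)
    ultimately have "(exp (- x) - \<alpha>) * (\<beta> - exp (- x)) \<le> 0" by (auto simp: mult_le_0_iff)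
    then show ?thesis by (simp add: \<phi>_def)
  qed
  have \<phi>_cont: "continuous_on A \<phi>" for A unfolding \<phi>_def by (intro continuous_intros)
  let ?g = "\<lambda>x. indicator {0<..} x *\<^sub>R (\<phi> (exp (- x)) * H x)"
  have g_nonneg: "0 \<le> ?g x" for x
    using \<phi>_pos[of x] \<phi>_0[of x] d(3)[of x] by (cases "\<bar>x - z\<bar> < d") (auto simp: indicator_def less_imp_le)
  have int: "integrable lborel ?g"
  proof -
    obtain M where M: "0 \<le> M" "\<And>x. x \<in> {0..1} \<Longrightarrow> \<bar>\<phi> x\<bar> \<le> M"
      by (rule continuous_on_Icc_bounded[OF \<phi>_cont]) (rule that)
    have "set_integrable lborel {0<..} (\<lambda>x. \<phi> (exp (- x)) * H x)"
    proof (rule set_integrable_bound)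
      show "set_integrable lborel {0<..} (\<lambda>x. M * H x)" using H by simp
      have "continuous_on {0<..} (\<lambda>x. \<phi> (exp (- x)) * H x)"
        by (intro continuous_on_mult cont continuous_on_compose2[OF \<phi>_cont[of UNIV]] continuous_intros) auto
      from borel_measurable_continuous_on_indicator[OF _ this]
      show "set_borel_measurable lborel {0<..} (\<lambda>x. \<phi> (exp (- x)) * H x)"
        by (simp add: set_borel_measurable_def)
      show "AE x in lborel. x \<in> {0<..} \<longrightarrow> norm (\<phi> (exp (- x)) * H x) \<le> norm (M * H x)"
        using M by (intro AE_I2) (auto simp: abs_mult intro!: mult_right_mono)
    qed
    then show ?thesis by (simp only: set_integrable_def)
  qed
  have "(\<integral>x. ?g x \<partial>lborel) = 0"
    using integral_compose_exp_eq_0[OF H zero \<phi>_cont borel_measurable_continuous_onI[OF \<phi>_cont]]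
    by (simp only: set_lebesgue_integral_def)
  then have "AE x in lborel. ?g x = 0"
    using integral_nonneg_eq_0_iff_AE[OF int] g_nonneg by auto
  then have "AE x in lborel. x \<notin> {z - d<..<z + d}"
  proof eventually_elim
    case (elim x)
    show ?case
    proof
      assume "x \<in> {z - d<..<z + d}"
      then have "\<bar>x - z\<bar> < d" "0 < x" using d(2) by auto
      then show False using \<phi>_pos[of x] d(3)[of x] elim by simp
    qed
  qed
  then have "{z - d<..<z + d} \<in> null_sets lborel"
    by (subst AE_iff_null_sets) auto
  then show False using d(1) by (auto simp: null_sets_def)
qed

text \<open>As 1/l is the transform of the constant 1, the transform of h - 1 vanishes for l \<ge>
  N; continuity of h gives the conclusion at every point.\<close>

lemma laplace_eq_imp_eq:
  fixes h :: "real \<Rightarrow> real"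
  assumes cont: "continuous_on {0<..} h" and nonneg: "\<And>x. 0 \<le> h x"
    and N: "0 < N" and eq: "\<And>l. N \<le> l \<Longrightarrow> nn_laplace h l = ennreal (1 / l)"
    and z: "0 < z"
  shows "h z = 1"
proof -
  have "has_bochner_integral lborel (\<lambda>x. indicator {0<..} x *\<^sub>R (exp (- l * x) * h' x)) (1 / l)"
    if h': "continuous_on {0<..} h'" "\<And>x. 0 \<le> h' x" "nn_laplace h' l = ennreal (1 / l)" and l: "N \<le> l"
    for h' :: "real \<Rightarrow> real" and l
  proof (rule has_bochner_integral_nn_integral)
    have "continuous_on {0<..} (\<lambda>x. exp (- l * x) * h' x)"
      by (intro continuous_intros h')
    from borel_measurable_continuous_on_indicator[OF _ this]
    show "(\<lambda>x. indicator {0<..} x *\<^sub>R (exp (- l * x) * h' x)) \<in> borel_measurable lborel"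
      by simp
    show "(\<integral>\<^sup>+ x. ennreal (indicator {0<..} x *\<^sub>R (exp (- l * x) * h' x)) \<partial>lborel) = ennreal (1 / l)"
      unfolding h'(3)[symmetric] nn_laplace_def
      by (intro nn_integral_cong) (auto simp: indicator_def)
  qed (use h'(2) N l in auto)
  note this[OF cont nonneg eq] this[of "\<lambda>_. 1"]
  moreover have "nn_laplace (\<lambda>_. 1) l = ennreal (1 / l)" if "N \<le> l" for l
    using nn_integral_exp_Ioi[of l] that N by (simp add: nn_laplace_def)
  ultimately have
    "has_bochner_integral lborel (\<lambda>x. indicator {0<..} x *\<^sub>R (exp (- l * x) * h x) -
       indicator {0<..} x *\<^sub>R (exp (- l * x) * 1)) (1 / l - 1 / l)" if "N \<le> l" for l
    using that by (intro has_bochner_integral_diff) auto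
  then have diff: "has_bochner_integral lborel (\<lambda>x. indicator {0<..} x *\<^sub>R (exp (- l * x) * (h x - 1))) 0" if "N \<le> l" for l
    using that by (simp add: right_diff_distrib)
  \<comment> \<open>Absorbing exp(-Nx) makes the function integrable and moves the zeros N + n of
    the transform to n = 0, 1, 2 and so on.\<close>
  define H where "H x = exp (- N * x) * (h x - 1)" for x
  have H: "set_integrable lborel {0<..} H"
    using diff[of N] by (simp add: H_def set_integrable_def has_bochner_integral_iff)
  have cont_H: "continuous_on {0<..} H"
    unfolding H_def by (intro continuous_intros cont)
  have zero: "(LINT x:{0<..}|lborel. exp (- real n * x) * H x) = 0" for n
  proof -
    have "exp (- (N + real n) * x) = exp (- real n * x) * exp (- N * x)" for x
      by (simp add: exp_add[symmetric] algebra_simps)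
    then show ?thesis
      using diff[of "N + real n"]
      by (simp add: H_def set_lebesgue_integral_def has_bochner_integral_iff mult.assoc)
  qed
  have "H z \<le> 0" by (rule laplace_eq_0_nonpos[OF H cont_H zero z])
  moreover have "- H z \<le> 0"
    by (rule laplace_eq_0_nonpos[where H="\<lambda>x. - H x"])
       (use H cont_H zero z in \<open>auto intro!: continuous_on_minus simp: set_integrable_def set_lebesgue_integral_def\<close>)
  ultimately show ?thesis by (simp add: H_def)
qed

section \<open>The Sonine pair of a complete Bernstein function\<close>

lemma continuous_on_conv_tail_kernels:
  assumes p: "tail_kernel p" and q: "tail_kernel q"
  shows "continuous_on {0<..T} (conv p q)"
proof -
  let ?D = "{x\<in>{0<..}. \<not> isCont p x} \<union> {x\<in>{0<..}. \<not> isCont q x}"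
  have "countable ?D"
    by (intro countable_Un tail_kernel_countable_discontinuities p q)
  then show ?thesis
    by (rule continuous_on_conv[OF p q, where A=1 and B=1 and D="?D", rotated 2])
       (auto intro!: set_borel_measurable_global
          simp: tail_kernelD(1,2)[OF p] tail_kernelD(1,2)[OF q])
qed

text \<open>The convolution is identified through its Laplace transform. The product formula is
  asked for from some N on, since the limit of f at infinity yields positivity of f for large
  l.\<close>

lemma sonine_of_nn_laplace:
  assumes p: "tail_kernel p" and q: "tail_kernel q" and N: "0 < N"
    and L: "\<And>l. N \<le> l \<Longrightarrow> nn_laplace p l * nn_laplace q l = ennreal (1 / l)"
    and z: "0 < z"
  shows "conv p q z = 1"
proof (rule laplace_eq_imp_eq[OF _ _ N _ z])
  show "continuous_on {0<..} (conv p q)"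
  proof (rule continuous_at_imp_continuous_on, rule ballI)
    fix x :: real assume x: "x \<in> {0<..}"
    \<comment> \<open>The interval reaches beyond x, so that x is an interior point.\<close>
    have "continuous_on {0<..<x + 1} (conv p q)"
      by (rule continuous_on_subset[OF continuous_on_conv_tail_kernels[OF p q, of "x + 1"]]) auto
    then show "isCont (conv p q) x"
      using x by (simp add: continuous_on_eq_continuous_at)
  qed
  show "0 \<le> conv p q x" for x
    unfolding conv_def set_lebesgue_integral_def
    using tail_kernelD(2)[OF p] tail_kernelD(2)[OF q]
    by (intro Bochner_Integration.integral_nonneg) auto
  show "nn_laplace (conv p q) l = ennreal (1 / l)" if "N \<le> l" for l
    using L[OF that] by (simp add: nn_laplace_conv[OF p q])
qed

text \<open>The integral is nonnegative, so f(l) is at least a + b l. The limit at 0 then gives a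
  \<le> 0, and the limit of f(x)/x at infinity gives b \<le> 0.\<close>

lemma bernstein_triplet_drift_free:
  assumes f: "bernstein_triplet f a b mu"
    and "(f \<longlongrightarrow> 0) (at_right 0)" "((\<lambda>x. f x / x) \<longlongrightarrow> 0) at_top"
  shows "a = 0" "b = 0"
proof -
  have ab: "0 \<le> a" "0 \<le> b"
    and feq: "\<And>l. 0 < l \<Longrightarrow> f l = a + b * l + (\<integral>t. (1 - exp (- l * t)) \<partial>mu)"
    using f by (auto simp: bernstein_triplet_def)
  have ge: "a + b * l \<le> f l" if "0 < l" for l
    using feq[OF that] bernstein_triplet_integral(1)[OF f that] by simp
  have "a \<le> 0"
  proof (rule tendsto_lowerbound[OF assms(2)])
    have "a \<le> f x" if "0 < x" for x
      using ge[OF that] mult_nonneg_nonneg[OF ab(2), of x] that by linarith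
    then show "\<forall>\<^sub>F x in at_right 0. a \<le> f x"
      by (auto intro: eventually_at_rightI[of 0 1])
  qed simp
  then show "a = 0" using ab by simp
  have "b \<le> 0"
  proof (rule tendsto_lowerbound[OF assms(3)])
    have ge_b: "b \<le> f x / x" if "0 < x" for x
      using ge[OF that] ab that by (simp add: pos_le_divide_eq)
    show "\<forall>\<^sub>F x in at_top. b \<le> f x / x"
      by (rule eventually_mono[OF eventually_gt_at_top[of 0] ge_b])
  qed simp
  then show "b = 0" using ab by simp
qed

text \<open>Taking conjugates swaps the four limits: divergence of f(x)/x at 0 and of f at infinity
  removes constant and drift from the conjugate, the other two remove them from f. The transforms of
  the tails are then f(l)/l and 1/f(l).\<close>

lemma sonine_of_condition_A1:
  assumes A1: "condition_A1 f" and f: "bernstein_triplet f a b mu"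
    and f': "bernstein_triplet (\<lambda>x. x / f x) a' b' mu'" and z: "0 < z"
  shows "conv (levy_tail mu) (levy_tail mu') z = 1"
proof -
  have f0: "(f \<longlongrightarrow> 0) (at_right 0)" and finf: "filterlim f at_top at_top"
    and fx0: "filterlim (\<lambda>x. f x / x) at_top (at_right 0)" and fxinf: "((\<lambda>x. f x / x) \<longlongrightarrow> 0) at_top"
    using A1 by (auto simp: condition_A1_def)
  have ab: "a = 0" "b = 0" by (rule bernstein_triplet_drift_free[OF f f0 fxinf])+
  have "((\<lambda>x. inverse (f x / x)) \<longlongrightarrow> 0) (at_right 0)"
    by (rule tendsto_inverse_0_at_top[OF fx0])
  then have c1: "((\<lambda>x. x / f x) \<longlongrightarrow> 0) (at_right 0)" by simp
  have "((\<lambda>x. inverse (f x)) \<longlongrightarrow> 0) at_top"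
    by (rule tendsto_inverse_0_at_top[OF finf])
  then have c2: "((\<lambda>x. x / f x / x) \<longlongrightarrow> 0) at_top"
  proof (rule Lim_transform_eventually)
    show "\<forall>\<^sub>F x in at_top. inverse (f x) = x / f x / x"
      using eventually_gt_at_top[of 0] by eventually_elim (simp add: field_simps)
  qed
  have ab': "a' = 0" "b' = 0" by (rule bernstein_triplet_drift_free[OF f' c1 c2])+
  have "eventually (\<lambda>x. 0 < f x) at_top"
    using finf by (auto simp: filterlim_at_top_dense)
  then obtain N where N: "\<And>x. N \<le> x \<Longrightarrow> 0 < f x" by (auto simp: eventually_at_top_linorder)
  show ?thesis
  proof (rule sonine_of_nn_laplace[OF tail_kernel_levy_tail[OF f] tail_kernel_levy_tail[OF f'] _ _ z])
    show "0 < max N 1" by simp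
    fix l assume "max N 1 \<le> l"
    then have l: "0 < l" "0 < f l" using N by auto
    have "f l = (\<integral>t. (1 - exp (- l * t)) \<partial>mu)"
      using f l(1) by (simp add: bernstein_triplet_def ab)
    then have L: "nn_laplace (levy_tail mu) l = ennreal (f l / l)"
      using bernstein_triplet_integral(2)[OF f l(1)] by simp
    have "l / f l = (\<integral>t. (1 - exp (- l * t)) \<partial>mu')"
      using f' l(1) by (simp add: bernstein_triplet_def ab')
    then have L': "nn_laplace (levy_tail mu') l = ennreal (l / f l / l)"
      using bernstein_triplet_integral(2)[OF f' l(1)] by simp
    show "nn_laplace (levy_tail mu) l * nn_laplace (levy_tail mu') l = ennreal (1 / l)"
      unfolding L L' using l by (simp add: ennreal_mult[symmetric])
  qed
qed

section \<open>Consequences of a completely monotone density\<close>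

lemma completely_monotoneD:
  assumes "completely_monotone m"
  shows "0 < x \<Longrightarrow> 0 \<le> m x" "continuous_on {0<..} m" "0 < x \<Longrightarrow> x \<le> y \<Longrightarrow> m y \<le> m x"
proof -
  have d: "m field_differentiable (at x)" "0 \<le> m x" "deriv m x \<le> 0" if "0 < x" for x
    using assms[unfolded completely_monotone_def, rule_format, of x 0]
      assms[unfolded completely_monotone_def, rule_format, of x 1] that by auto
  show "0 \<le> m x" if "0 < x" using d that by auto
  show "continuous_on {0<..} m"
    using d(1) by (intro continuous_at_imp_continuous_on)
      (auto intro: field_differentiable_imp_continuous_at)
  show "m y \<le> m x" if "0 < x" "x \<le> y"
  proof (rule DERIV_nonpos_imp_nonincreasing[OF \<open>x \<le> y\<close>])
    fix z assume "x \<le> z" "z \<le> y"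
    then have "0 < z" using that by simp
    then show "\<exists>d. DERIV m z :> d \<and> d \<le> 0"
      using d[of z] field_differentiable_derivI by blast
  qed
qed

context
  fixes m :: "real \<Rightarrow> real" and mu :: "real measure"
  assumes m: "completely_monotone m"
    and mu: "mu = density (restrict_space lborel {0<..}) (\<lambda>t. ennreal (m t))"
    and levy: "levy_measure mu"
begin

lemma emeasure_mu_density:
  assumes "A \<in> sets borel" "A \<subseteq> {0<..}"
  shows "emeasure mu A = (\<integral>\<^sup>+ t. ennreal (m t) * indicator A t \<partial>lborel)"
proof -
  have meas: "(\<lambda>t. ennreal (m t)) \<in> borel_measurable (restrict_space lborel {0<..})"
    using borel_measurable_continuous_on_restrict[OF completely_monotoneD(2)[OF m]]
    by (simp cong: measurable_cong_sets add: sets_restrict_space)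
  have "A = {0<..} \<inter> A" using assms by auto
  then have "A \<in> sets (restrict_space lborel {0<..})"
    using assms(1) unfolding sets_restrict_space by (intro image_eqI) auto
  then have "emeasure mu A = (\<integral>\<^sup>+ t. ennreal (m t) * indicator A t \<partial>restrict_space lborel {0<..})"
    unfolding mu by (rule emeasure_density[OF meas])
  also have "\<dots> = (\<integral>\<^sup>+ t. ennreal (m t) * indicator A t * indicator {0<..} t \<partial>lborel)"
    by (rule nn_integral_restrict_space) simp
  also have "\<dots> = (\<integral>\<^sup>+ t. ennreal (m t) * indicator A t \<partial>lborel)"
    using assms(2) by (intro nn_integral_cong) (auto simp: indicator_def)
  finally show ?thesis .
qed

text \<open>A density leaves no atom at x, so the indicators of the rays converge almost everywhere;
  the ray beyond x/2 has finite mass and provides the majorant.\<close>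

lemma isCont_levy_tail:
  assumes x: "0 < x"
  shows "isCont (levy_tail mu) x"
  unfolding continuous_at_sequentially
proof (intro allI impI)
  fix X :: "nat \<Rightarrow> real" assume lim: "X \<longlonglongrightarrow> x"
  define d where "d = x / 2"
  have d: "0 < d" "d < x" using x by (auto simp: d_def)
  from order_tendstoD(1)[OF lim d(2)] obtain N where N: "\<And>n. n \<ge> N \<Longrightarrow> d < X n"
    by (auto simp: eventually_sequentially)
  define Y where "Y n = X (n + N)" for n
  have Y: "d < Y n" for n using N[of "n + N"] by (simp add: Y_def)
  have Ylim: "Y \<longlonglongrightarrow> x" unfolding Y_def using lim by (rule LIMSEQ_ignore_initial_segment)
  note S = levy_measureD(3)[OF levy]
  have tail: "levy_tail mu y = (\<integral>t. indicator {y<..} t \<partial>mu)" if "0 < y" for y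
    using S[of y] that by (simp add: levy_tail_def)
  have "{x} = {0<..} \<inter> {x}" using x by auto
  then have "{x} \<in> (\<inter>) {0<..} ` sets borel" by (rule image_eqI) simp
  then have single: "{x} \<in> sets mu" by (simp add: mu sets_restrict_space)
  have "emeasure mu {x} = 0"
  proof -
    have "AE t in lborel. ennreal (m t) * indicator {x} t = 0"
      using AE_lborel_singleton[of x] by eventually_elim simp
    then have "(\<integral>\<^sup>+ t. ennreal (m t) * indicator {x} t \<partial>lborel) = (\<integral>\<^sup>+ t. 0 \<partial>(lborel :: real measure))"
      by (rule nn_integral_cong_AE)
    then show ?thesis using x by (subst emeasure_mu_density) auto
  qed
  then have ae: "AE t in mu. t \<noteq> x"
    using single by (intro AE_I[of _ _ "{x}"]) auto
  have "(\<lambda>n. \<integral>t. indicator {Y n<..} t \<partial>mu) \<longlonglongrightarrow> (\<integral>t. (indicator {x<..} t :: real) \<partial>mu)"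
  proof (rule integral_dominated_convergence)
    show "integrable mu (indicator {d<..} :: real \<Rightarrow> real)"
      using S[of d] levy_measureD(5)[OF levy d(1)] d by (intro integrable_real_indicator) auto
    show "AE t in mu. (\<lambda>n. indicator {Y n<..} t) \<longlonglongrightarrow> (indicator {x<..} t :: real)"
      using ae
    proof eventually_elim
      case (elim t)
      then consider "t < x" | "x < t" by linarith
      then have "\<forall>\<^sub>F n in sequentially. indicator {x<..} t = (indicator {Y n<..} t :: real)"
      proof cases
        case 1
        from order_tendstoD(1)[OF Ylim this] show ?thesis
          by eventually_elim (use 1 in \<open>auto simp: indicator_def\<close>)
      next
        case 2
        from order_tendstoD(2)[OF Ylim this] show ?thesis
          by eventually_elim (use 2 in \<open>auto simp: indicator_def\<close>)
      qed
      then show ?case by (rule Lim_transform_eventually[OF tendsto_const])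
    qed
    show "AE t in mu. norm (indicator {Y n<..} t :: real) \<le> indicator {d<..} t" for n
      using Y[of n] by (intro AE_I2) (auto simp: indicator_def)
    show "indicator {Y n<..} \<in> borel_measurable mu" for n
      using S[of "Y n"] Y[of n] d by (intro borel_measurable_indicator) auto
  qed (use S[of x] x in auto)
  then have "(\<lambda>n. levy_tail mu (Y n)) \<longlonglongrightarrow> levy_tail mu x"
    using tail[OF x] tail[OF less_trans[OF d(1) Y]] by simp
  then have "(\<lambda>n. levy_tail mu (X n)) \<longlonglongrightarrow> levy_tail mu x"
    unfolding Y_def by (rule LIMSEQ_offset)
  then show "(levy_tail mu \<circ> X) \<longlonglongrightarrow> levy_tail mu x" by (simp add: o_def)
qed

text \<open>If m vanished at y it would vanish beyond, being nonincreasing, and the tail at y would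
  be 0. Hence m is at least m(y) > 0 on (x,y], which therefore has positive mass.\<close>

lemma levy_tail_strict_decreasing:
  assumes xy: "0 < x" "x < y" and pos: "0 < levy_tail mu y"
  shows "levy_tail mu y < levy_tail mu x"
proof -
  note S = levy_measureD(3,5)[OF levy]
  have "m y \<noteq> 0"
  proof
    assume my: "m y = 0"
    have zero: "m t = 0" if "y < t" for t
      using completely_monotoneD(1)[OF m, of t] completely_monotoneD(3)[OF m, of y t] my that xy by simp
    have "emeasure mu {y<..} = (\<integral>\<^sup>+ t. ennreal (m t) * indicator {y<..} t \<partial>lborel)"
      using xy by (intro emeasure_mu_density) auto
    also have "\<dots> = (\<integral>\<^sup>+ t. 0 \<partial>(lborel :: real measure))"
      by (intro nn_integral_cong) (auto simp: indicator_def zero)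
    finally show False using pos by (simp add: levy_tail_def measure_def)
  qed
  then have my: "0 < m y" using completely_monotoneD(1)[OF m, of y] xy by simp
  have "ennreal (m y * (y - x)) = (\<integral>\<^sup>+ t. ennreal (m y) * indicator {x<..y} t \<partial>lborel)"
    using my xy by (simp add: nn_integral_cmult_indicator ennreal_mult)
  also have "\<dots> \<le> (\<integral>\<^sup>+ t. ennreal (m t) * indicator {x<..y} t \<partial>lborel)"
    using xy completely_monotoneD(3)[OF m, of _ y]
    by (intro nn_integral_mono) (auto simp: indicator_def intro!: ennreal_leI)
  also have "\<dots> = emeasure mu {x<..y}"
    using xy by (intro emeasure_mu_density[symmetric]) auto
  finally have "0 < emeasure mu {x<..y}"
    using my xy by (auto intro: less_le_trans[rotated])
  moreover have eq: "{x<..y} = {x<..} - {y<..}" using xy by auto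
  moreover have "emeasure mu ({x<..} - {y<..}) = emeasure mu {x<..} - emeasure mu {y<..}"
    using S(1)[of x] S(1)[of y] S(2)[of y] xy by (intro emeasure_Diff) auto
  ultimately have "emeasure mu {y<..} < emeasure mu {x<..}"
    using diff_eq_0_ennreal[of "emeasure mu {x<..}" "emeasure mu {y<..}"] S(2)[OF xy(1)]
    by (cases "emeasure mu {x<..} \<le> emeasure mu {y<..}") auto
  then show ?thesis
    using S[of x] S[of y] xy unfolding levy_tail_def measure_def
    by (intro enn2real_less_iff[THEN iffD2]) (auto simp: less_top[symmetric])
qed

end

text \<open>Replacing p(x - s) by the smaller p(x) under the integral can only lose mass. No loss
  would force q = 0 almost everywhere on (0,x), and then the integral could not reach 1. Strict
  monotonicity is asked for where p(x) > 0; at p(x) = 0 the product is 0.\<close>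

lemma sonine_strict:
  assumes p: "tail_kernel p" and q: "tail_kernel q"
    and one: "conv p q x = 1" and x: "0 < x"
    and strict: "\<And>y. 0 < y \<Longrightarrow> y < x \<Longrightarrow> 0 < p x \<Longrightarrow> p x < p y"
  shows "p x * (LINT s:{0<..<x}|lborel. q s) < 1"
proof (rule ccontr)
  assume "\<not> ?thesis"
  then have ge: "1 \<le> (LINT s:{0<..<x}|lborel. p x * q s)" by simp
  then have px: "0 < p x"
    using tail_kernelD(2)[OF p, of x] by (cases "p x = 0") auto
  have i: "set_integrable lborel {0<..<x} (\<lambda>s. p (x - s) * q s)"
      "set_integrable lborel {0<..<x} (\<lambda>s. p x * q s)"
    using tail_kernel_mult_integrable[OF p q] tail_kernelD(4)[OF q] by auto
  then have int: "set_integrable lborel {0<..<x} (\<lambda>s. p (x - s) * q s - p x * q s)"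
    by (rule set_integral_diff(1))
  let ?g = "\<lambda>s. indicator {0<..<x} s *\<^sub>R (p (x - s) * q s - p x * q s)"
  have nonneg: "0 \<le> ?g s" for s
    using tail_kernelD(2)[OF q, of s] tail_kernelD(3)[OF p, of "x - s" x]
    by (auto simp: indicator_def left_diff_distrib[symmetric])
  have "(LINT s:{0<..<x}|lborel. p (x - s) * q s - p x * q s) \<le> 0"
    using i ge one by (simp add: set_integral_diff(2) conv_def)
  then have "(\<integral>s. ?g s \<partial>lborel) = 0"
    unfolding set_lebesgue_integral_def
    using nonneg by (intro antisym Bochner_Integration.integral_nonneg) auto
  then have "AE s in lborel. ?g s = 0"
    using integral_nonneg_eq_0_iff_AE[OF int[unfolded set_integrable_def]] nonneg by auto
  then have "AE s in lborel. indicator {0<..<x} s *\<^sub>R (p x * q s) = 0"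
  proof eventually_elim
    case (elim s)
    show ?case
    proof (cases "s \<in> {0<..<x}")
      case True
      then have "(p (x - s) - p x) * q s = 0" "p x < p (x - s)"
        using elim strict[of "x - s"] px by (auto simp: left_diff_distrib)
      then show ?thesis by auto
    qed simp
  qed
  then have "(LINT s:{0<..<x}|lborel. p x * q s) = 0"
    unfolding set_lebesgue_integral_def by (rule integral_eq_zero_AE)
  with ge show False by linarith
qed

lemma uniform_bound_less_1:
  fixes F :: "real \<Rightarrow> real"
  assumes cont: "continuous_on {0<..T} F" and less: "\<And>x. 0 < x \<Longrightarrow> x \<le> T \<Longrightarrow> F x < 1"
    and limsup: "Limsup (at_right 0) (\<lambda>x. ereal (F x)) < 1" and T: "0 < T"
  obtains \<gamma> where "\<gamma> < 1" "\<And>x. 0 < x \<Longrightarrow> x \<le> T \<Longrightarrow> F x \<le> \<gamma>"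
proof -
  obtain r where r: "Limsup (at_right 0) (\<lambda>x. ereal (F x)) < ereal r" "ereal r < 1"
    using ereal_dense2[OF limsup] by auto
  have "\<forall>\<^sub>F x in at_right 0. ereal (F x) < ereal r" by (rule Limsup_lessD[OF r(1)])
  then obtain d where d: "0 < d" "\<And>x. 0 < x \<Longrightarrow> x < d \<Longrightarrow> F x < r"
    by (auto simp: eventually_at_right_field)
  define e where "e = min d T"
  have e: "0 < e" "e \<le> d" "e \<le> T" using d T by (auto simp: e_def)
  have "continuous_on {e..T} F" by (rule continuous_on_subset[OF cont]) (use e in auto)
  moreover have "{e..T} \<noteq> {}" using e by simp
  ultimately obtain z where z: "z \<in> {e..T}" "\<forall>x\<in>{e..T}. F x \<le> F z"
    using continuous_attains_sup[OF compact_Icc] by blast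
  show thesis
  proof (rule that[of "max r (F z)"])
    show "max r (F z) < 1" using r(2) less[of z] z(1) e by (auto simp: one_ereal_def)
    fix x assume x: "0 < x" "x \<le> T"
    show "F x \<le> max r (F z)"
    proof (cases "x < e")
      case True
      then show ?thesis using d(2)[of x] x e by simp
    next
      case False
      then have "F x \<le> F z" using z(2) x by simp
      then show ?thesis by simp
    qed
  qed
qed

theorem theorem4p3:
  fixes f mubar k g :: "real \<Rightarrow> real"
    and mu mu_star :: "real measure"
    and a b a_star b_star T \<phi>\<^sub>0 l :: real
  assumes A1: "condition_A1 f"
    and A2: "complete_bernstein_triplet f a b mu"
    and conjugate: "bernstein_triplet (\<lambda>x. x / f x) a_star b_star mu_star"
    and mubar: "mubar = levy_tail mu"
    and k: "k = levy_tail mu_star"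
    and limsup: "Limsup (at_right 0) (\<lambda>x. ereal (mubar x * (LINT s:{0<..<x}|lborel. k s))) < 1"
    and T: "T > 0"
    and l: "l \<noteq> 0"
    and g: "continuous_on {0..T} g"
  shows "\<exists>\<phi>\<in>C_Icc mubar T.
           solves_ivp mubar T \<phi>\<^sub>0 l g \<phi> \<and>
           (\<forall>\<psi>\<in>C_Icc mubar T. solves_ivp mubar T \<phi>\<^sub>0 l g \<psi> \<longrightarrow> (\<forall>x\<in>{0..T}. \<psi> x = \<phi> x)) \<and>
           (\<forall>x\<in>{0..T}.
              summable (\<lambda>i. l ^ i * (I_Ce mubar k ^^ i) (\<lambda>_. 1) x) \<and>
              summable (\<lambda>i. l ^ i * (I_Ce mubar k ^^ (i + 1)) g x) \<and>
              \<phi> x = \<phi>\<^sub>0 * (\<Sum>i. l ^ i * (I_Ce mubar k ^^ i) (\<lambda>_. 1) x)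
                    + (\<Sum>i. l ^ i * (I_Ce mubar k ^^ (i + 1)) g x))"
proof -
  have f: "bernstein_triplet f a b mu" using A2 by (simp add: complete_bernstein_triplet_def)
  then have levy: "levy_measure mu" by (simp add: bernstein_triplet_def)
  obtain m where m: "completely_monotone m"
    "mu = density (restrict_space lborel {0<..}) (\<lambda>t. ennreal (m t))"
    using A2 by (auto simp: complete_bernstein_triplet_def)
  have tk: "tail_kernel mubar" "tail_kernel k"
    unfolding mubar k by (rule tail_kernel_levy_tail[OF f] tail_kernel_levy_tail[OF conjugate])+
  have cont: "isCont mubar x" if "0 < x" for x
    unfolding mubar by (rule isCont_levy_tail[OF m levy that])
  have one: "conv mubar k x = 1" if "0 < x" for x
    unfolding mubar k by (rule sonine_of_condition_A1[OF A1 f conjugate that])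
  \<comment> \<open>\<kappa> is written as the convolution of the constant 1 with \<open>k\<close>,
    so its continuity is that of a convolution of tail kernels.\<close>
  have "continuous_on {0<..T} (\<lambda>x. mubar x * conv (\<lambda>_. 1) k x)"
    using cont tk(2) by (intro continuous_on_mult continuous_on_conv_tail_kernels tail_kernel_const
        continuous_at_imp_continuous_on) auto
  then have "continuous_on {0<..T} (\<lambda>x. mubar x * (LINT s:{0<..<x}|lborel. k s))"
    by (simp add: conv_def)
  moreover have "mubar x * (LINT s:{0<..<x}|lborel. k s) < 1" if "0 < x" for x
    using levy_tail_strict_decreasing[OF m levy]
    by (intro sonine_strict tk one that) (simp add: mubar)
  ultimately obtain \<gamma> where \<gamma>: "\<gamma> < 1"
    "\<And>x. 0 < x \<Longrightarrow> x \<le> T \<Longrightarrow> mubar x * (LINT s:{0<..<x}|lborel. k s) \<le> \<gamma>"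
    using uniform_bound_less_1[OF _ _ limsup T] by blast
  interpret sonine_contraction mubar k T \<gamma>
    by unfold_locales (fact tk cont one T \<gamma>)+
  have gC: "g \<in> CT" and oneC: "(\<lambda>_. 1) \<in> CT" using g by auto
  show ?thesis
  proof (intro bexI[OF _ censored_ivp(1)[OF gC]] conjI ballI impI)
    show "solves_ivp mubar T \<phi>\<^sub>0 l g
        (\<lambda>x. \<phi>\<^sub>0 * (\<Sum>i. l ^ i * (J ^^ i) (\<lambda>_. 1) x) + (\<Sum>i. l ^ i * (J ^^ (i + 1)) g x))"
      by (rule censored_ivp(2)[OF gC])
    fix x assume x: "x \<in> {0..T}"
    show "summable (\<lambda>i. l ^ i * (J ^^ i) (\<lambda>_. 1) x)"
      by (rule neumann_summable[OF oneC x])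
    show "summable (\<lambda>i. l ^ i * (J ^^ (i + 1)) g x)"
      by (rule sums_summable[OF J_neumann[OF gC x]])
  qed (rule censored_ivp(3)[OF gC], assumption+, rule refl)
qed

end
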